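(* Let $B$ be a star-shaped domain in $\mathbb{R}^n$ and let $w_0:\mathbb{R}^n\to\mathbb{R}_+$ be a $1$-homogeneous measurable function with $\int_B w_0(x)\,dx<\infty$. Let $\varphi:(0,\infty)\to\mathbb{R}_+$ be a non-increasing log-convex function, non-integrable at the origin and integrable at infinity. Set $$\mu=w_0(x/\|x\|_B)\,\|x\|_B^{1-n}\,\varphi(\|x\|_B)\,dx .$$ Then, denoting $\Phi(t):=\int_t^\infty\varphi(s)\,ds$ and $I:=\varphi\circ\Phi^{-1}$, we have: (1) $\mu^-_B(C)\ge I(\mu(C))$ for any Borel set $C\subset\mathbb{R}^n$ with $\mu(C)<\infty$. (2) If $B$ is in addition convex, complements of homothetic copies of $B$ are isoperimetric minimizers for $(\mathbb{R}^n,\|\cdot\|_B,\mu)$. (3) $\mu$ is $B$-one-sided $\Phi^{-1}$-complemented-concave: $$\mu_*(\mathbb{R}^n\setminus(A+tB))\le\Phi\big(\Phi^{-1}(\mu(\mathbb{R}^n\setminus A))+t\,\Phi^{-1}(\mu(\mathbb{R}^n\setminus B))\big)$$ for all $t\ge0$ and any Borel set $A\subset\mathbb{R}^n$ with $\mu(\mathbb{R}^n\setminus A)<\infty$.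
   Context: A Borel set $B\subset\mathbb{R}^n$ is a star-shaped domain if there is a measurable function $\rho_B:S^{n-1}\to(0,\infty)$ with $B=\{r\theta:\theta\in S^{n-1},\ r\in[0,\rho_B(\theta))\}$. Set $\|\theta\|_B=1/\rho_B(\theta)$ for $\theta\in S^{n-1}$ and extend $\|\cdot\|_B$ to $\mathbb{R}^n$ as a (positively) $1$-homogeneous function. $w_0$ is $1$-homogeneous if $w_0(\lambda x)=\lambda w_0(x)$ for all $x$ and all $\lambda>0$. Log-convex means that $\log\varphi:(0,\infty)\to[-\infty,\infty)$ is convex. Inner boundary measure with respect to $B$: $\mu^-_B(C)=\liminf_{\epsilon\to0^+}\frac{\mu((A+\epsilon B)\setminus A)}{\epsilon}$ with $A=\mathbb{R}^n\setminus C$, where $+$ denotes Minkowski addition; when $B$ is convex this is the boundary measure associated with $\|\cdot\|_B$. Isoperimetric minimizers are sets of given measure on which the sharp lower bound on the (inner) boundary measure, as a function of the measure of the set, is attained. $\mu_*$ is the inner measure induced by $\mu$. Homothetic copies of $B$ are the sets $tB$, $t>0$. Conventions: $\varphi(\infty)=0$; $\Phi^{-1}(0)=\infty$ if the support of $\Phi$ is not compact, and $\Phi^{-1}(0)=z$ if that support is $[0,z]$ with $z<\infty$.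
   Formalization: Φ and I are built from cφ, c=(n+1)∫_B w_0 dx, instead of φ (μ is unchanged); they agree when c=1. As printed, (1) fails for n=1, B=(-1,1), w_0=k|x|, φ(s)=s^{-2}, k>1/2, C=R\tB; (3) also needs this normalization. *)

theory Defs
  imports "HOL-Analysis.Analysis"
begin

definition star_shaped_domain :: "(real ^ 'n) set \<Rightarrow> (real ^ 'n \<Rightarrow> real) \<Rightarrow> bool" where
  "star_shaped_domain B \<rho> \<longleftrightarrow>
     B \<in> sets borel \<and>
     \<rho> \<in> borel_measurable (restrict_space borel (sphere 0 1)) \<and>
     (\<forall>\<theta>\<in>sphere 0 1. 0 < \<rho> \<theta>) \<and>
     B = {r *\<^sub>R \<theta> | r \<theta>. \<theta> \<in> sphere 0 1 \<and> 0 \<le> r \<and> r < \<rho> \<theta>}"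

(* sgn x is x / |x|, and 0 for x = 0; only the values of \<rho> on the unit sphere matter. *)
definition star_norm :: "(real ^ 'n \<Rightarrow> real) \<Rightarrow> real ^ 'n \<Rightarrow> real" where
  "star_norm \<rho> x = norm x / \<rho> (sgn x)"

definition one_homogeneous :: "(real ^ 'n \<Rightarrow> real) \<Rightarrow> bool" where
  "one_homogeneous w \<longleftrightarrow> (\<forall>x. \<forall>t>0. w (t *\<^sub>R x) = t * w x)"

definition ext_ln :: "real \<Rightarrow> ereal" where
  "ext_ln x = (if x = 0 then -\<infinity> else ereal (ln x))"

(* Convexity of log \<phi> with values in [-\<infinity>, \<infinity>). *)
definition log_convex :: "(real \<Rightarrow> real) \<Rightarrow> bool" where
  "log_convex \<phi> \<longleftrightarrow>
     (\<forall>x>0. \<forall>y>0. \<forall>u>0. \<forall>v>0. u + v = 1 \<longrightarrow>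
        ext_ln (\<phi> (u * x + v * y)) \<le> ereal u * ext_ln (\<phi> x) + ereal v * ext_ln (\<phi> y))"

(* The measure lives on the Lebesgue sigma-algebra, since the weight w need only be Lebesgue
   measurable. The value of the density at the origin is irrelevant. *)
definition radial_measure ::
    "(real ^ 'n \<Rightarrow> real) \<Rightarrow> (real ^ 'n \<Rightarrow> real) \<Rightarrow> (real \<Rightarrow> real) \<Rightarrow> (real ^ 'n) measure" where
  "radial_measure \<rho> w \<phi> =
     density lebesgue (\<lambda>x. ennreal
       (w (x /\<^sub>R star_norm \<rho> x) * star_norm \<rho> x powi (1 - int CARD('n)) * \<phi> (star_norm \<rho> x)))"

(* The constant (n + 1) * (integral of w over B). Integration in polar coordinates gives
   mu(R^n - t B) = weight_const B w * (integral of \<phi> over (t, \<infinity>)) for t > 0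
   when mu = radial_measure \<rho> w \<phi>. Hence mu has to be compared with the one-dimensional density
   weight_const B w * \<phi>, which is \<phi> itself under the normalization weight_const B w = 1. With \<phi>
   in its place the bounds fail without normalization: for n = 1, B = (-1, 1), w(x) = k |x| and
   \<phi>(s) = s^(-2) the complement of t B has measure 2 k / t and boundary measure 2 k / t^2, while
   tail_profile \<phi> m = m^2 would require 4 k^2 / t^2 \<le> 2 k / t^2. *)
definition weight_const :: "(real ^ 'n) set \<Rightarrow> (real ^ 'n \<Rightarrow> real) \<Rightarrow> real" where
  "weight_const B w = (real CARD('n) + 1) * (LINT x:B|lebesgue. w x)"

(* The tail \<Phi>(t), t in [0, \<infinity>], of a function \<phi> on (0, \<infinity>). *)
definition tail :: "(real \<Rightarrow> real) \<Rightarrow> ennreal \<Rightarrow> ennreal" where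
  "tail \<phi> t = (\<integral>\<^sup>+ s \<in> {s. 0 < s \<and> t < ennreal s}. ennreal (\<phi> s) \<partial>lborel)"

(* For m = 0 this is the right end point of the support of the tail, which is \<infinity> if that
   support is not compact. *)
definition tail_inv :: "(real \<Rightarrow> real) \<Rightarrow> ennreal \<Rightarrow> ennreal" where
  "tail_inv \<phi> m = (if m = 0 then Sup {t. tail \<phi> t \<noteq> 0} else (THE t. tail \<phi> t = m))"

(* \<phi> extended by \<phi>(\<infinity>) = 0. *)
definition ext_at_infinity :: "(real \<Rightarrow> real) \<Rightarrow> ennreal \<Rightarrow> ennreal" where
  "ext_at_infinity \<phi> t = (if t = \<infinity> then 0 else ennreal (\<phi> (enn2real t)))"

definition tail_profile :: "(real \<Rightarrow> real) \<Rightarrow> ennreal \<Rightarrow> ennreal" where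
  "tail_profile \<phi> = ext_at_infinity \<phi> \<circ> tail_inv \<phi>"

definition inner_measure_of :: "'a measure \<Rightarrow> 'a set \<Rightarrow> ennreal" where
  "inner_measure_of M A = (SUP K \<in> {K \<in> sets M. K \<subseteq> A}. emeasure M K)"

definition minkowski_add :: "(real ^ 'n) set \<Rightarrow> real \<Rightarrow> (real ^ 'n) set \<Rightarrow> (real ^ 'n) set" where
  "minkowski_add A t B = {a + t *\<^sub>R b | a b. a \<in> A \<and> b \<in> B}"

(* For Borel sets A and B the sum A + e B is analytic, hence Lebesgue measurable, so that
   outer_measure_of is just the value of the measure; it avoids the value 0 that emeasure would
   give to a set not yet known to be measurable. *)
definition inner_boundary_measure ::
    "(real ^ 'n) measure \<Rightarrow> (real ^ 'n) set \<Rightarrow> (real ^ 'n) set \<Rightarrow> ennreal" where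
  "inner_boundary_measure M B C =
     Liminf (at_right 0) (\<lambda>\<epsilon>. outer_measure_of M (minkowski_add (- C) \<epsilon> B - (- C)) / ennreal \<epsilon>)"

definition isoperimetric_profile ::
    "(real ^ 'n) measure \<Rightarrow> (real ^ 'n) set \<Rightarrow> ennreal \<Rightarrow> ennreal" where
  "isoperimetric_profile M B v =
     (INF C \<in> {C \<in> sets borel. emeasure M C = v}. inner_boundary_measure M B C)"

definition isoperimetric_minimizer ::
    "(real ^ 'n) measure \<Rightarrow> (real ^ 'n) set \<Rightarrow> (real ^ 'n) set \<Rightarrow> bool" where
  "isoperimetric_minimizer M B C \<longleftrightarrow>
     C \<in> sets borel \<and>
     inner_boundary_measure M B C = isoperimetric_profile M B (emeasure M C)"

(* F and G play the roles of \<Phi> and its inverse. *)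
definition one_sided_complemented_concave ::
    "(real ^ 'n) measure \<Rightarrow> (real ^ 'n) set \<Rightarrow> (ennreal \<Rightarrow> ennreal) \<Rightarrow> (ennreal \<Rightarrow> ennreal) \<Rightarrow> bool"
  where
  "one_sided_complemented_concave M B F G \<longleftrightarrow>
     (\<forall>t\<ge>0. \<forall>A\<in>sets borel. emeasure M (- A) < \<infinity> \<longrightarrow>
        inner_measure_of M (- minkowski_add A t B)
          \<le> F (G (emeasure M (- A)) + ennreal t * G (emeasure M (- B))))"

end

(* In polar coordinates adapted to B the measure becomes d\<nu>(\<theta>) \<phi>(r) dr, where \<nu> is the cone measure
   of B, of total mass c. If a point r \<theta> avoids A + t B, then the half-open segment from (r - t) \<theta>
   (excluded) to r \<theta> avoids A; as \<phi> is not integrable at 0, almost every ray of a set K outside A + t B stays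
   beyond radius t when A has a complement of finite measure. Shifting K towards the origin by
   \<tau> < t therefore lands in the complement of A, so that

     \<mu>(-A) \<ge> integral over K of \<phi>(r - \<tau>) / \<phi>(r) d\<mu>.

   By log-convexity the ratio is non-increasing in r, so among all sets of the measure of K the
   integral is smallest for the complement of a ball {r > z}, where it is the tail at z - \<tau>.
   Letting \<tau> tend to t gives the concavity inequality. The isoperimetric inequality is its
   derivative at t = 0, with equality for complements of dilates of B when B is convex, because then
   t B + \<epsilon> B = (t + \<epsilon>) B. *)

theory Submission
  imports Defs
begin

section \<open>Log-convex densities and their tails\<close>

text \<open>Polar coordinates rest on homogeneity alone: \<open>w\<close> has degree 1 and Lebesgue
  measure degree n, so \<open>w dx\<close> scales with degree n + 1 and splits into a measure on
  directions times r^n dr. The weight is only Lebesgue measurable, while products and polar maps are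
  handled on Borel sets; hence \<open>w dx\<close> is first pushed to the Borel sets, and Lebesgue
  measurable sets are recovered later by discarding a null set. The directions have total mass c, so
  the one-dimensional density to compare with is \<psi> = c \<phi>. The theory of tails is therefore
  set up for a class of densities closed under positive scaling, and c = 0 is treated apart.
  \<open>B\<close> is the strict sublevel set \<open>N x < 1\<close>, so shifts by
  \<open>\<tau> < t\<close> are available but not the shift by \<open>t\<close> itself; this is the
  origin of the limit in \<tau>. No tail is ever differentiated: monotonicity of the density bounds
  increments of the tail from both sides, and continuity of the density turns this into a bound on
  the boundary measure. Since the boundary layer is measured from outside, the estimate is applied
  to what remains after removing an arbitrary measurable cover of it.\<close>

lemma log_convex_pos:
  assumes nonneg: "\<And>s. 0 < s \<Longrightarrow> 0 \<le> \<phi> s" and lc: "log_convex \<phi>"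
    and y: "0 < y" "\<phi> y \<noteq> 0" and x: "0 < x"
  shows "0 < \<phi> x"
proof (rule ccontr)
  assume "\<not> 0 < \<phi> x"
  with nonneg x have x0: "\<phi> x = 0" by force
  then have "x \<noteq> y" using y by auto
  \<comment> \<open>\<open>y\<close> is put strictly between \<open>x\<close> and a positive point
    \<open>p\<close>; the value \<open>-\<infinity>\<close> at \<open>x\<close> then drags the
    logarithm down to \<open>-\<infinity>\<close> at \<open>y\<close>. For \<open>x < y\<close> the
    point \<open>p\<close> is the reflection of \<open>x\<close> in \<open>y\<close>; for
    \<open>y < x\<close> a reflection could leave the positive axis, so
    \<open>p = y/2\<close>.\<close>
  obtain u v p where uv: "0 < u" "0 < v" "u + v = 1" "0 < p" "u * x + v * p = y"
  proof (cases "x < y")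
    case True
    show ?thesis
      by (rule that[of "1/2" "1/2" "2 * y - x"]) (use True x in \<open>auto simp: field_simps\<close>)
  next
    case False
    with \<open>x \<noteq> y\<close> have "y < x" by simp
    show ?thesis
      by (rule that[of "(y/2) / (x - y/2)" "(x - y) / (x - y/2)" "y/2"])
        (use \<open>y < x\<close> y in \<open>auto simp: divide_simps\<close>, algebra+)
  qed
  have "ext_ln (\<phi> (u * x + v * p)) \<le> ereal u * ext_ln (\<phi> x) + ereal v * ext_ln (\<phi> p)"
    using lc uv x unfolding log_convex_def by blast
  moreover have "ereal u * ext_ln (\<phi> x) = -\<infinity>"
    using uv by (simp add: ext_ln_def x0)
  moreover have "ereal v * ext_ln (\<phi> p) \<noteq> \<infinity>"
    using uv by (simp add: ext_ln_def)
  ultimately have "ext_ln (\<phi> y) = -\<infinity>"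
    using uv by (cases "ereal v * ext_ln (\<phi> p)") auto
  then show False
    using y by (auto simp: ext_ln_def split: if_splits)
qed

lemma log_convex_convex_on:
  assumes pos: "\<And>s. 0 < s \<Longrightarrow> 0 < \<phi> s" and lc: "log_convex \<phi>"
  shows "convex_on {0<..} (\<lambda>s. ln (\<phi> s))"
proof (rule convex_onI)
  fix u x y :: real
  assume u: "0 < u" "u < 1" and xy: "x \<in> {0<..}" "y \<in> {0<..}"
  have "ext_ln (\<phi> ((1 - u) * x + u * y)) \<le> ereal (1 - u) * ext_ln (\<phi> x) + ereal u * ext_ln (\<phi> y)"
    using lc u xy unfolding log_convex_def by auto
  moreover have "0 < (1 - u) * x + u * y"
    using u xy by (simp add: add_pos_pos)
  ultimately show "ln (\<phi> ((1 - u) *\<^sub>R x + u *\<^sub>R y)) \<le> (1 - u) * ln (\<phi> x) + u * ln (\<phi> y)"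
    using pos[of x] pos[of y] pos[of "(1 - u) * x + u * y"] xy by (simp add: ext_ln_def)
qed simp

text \<open>Both \<open>a + h\<close> and \<open>b\<close> are convex combinations of
  \<open>a\<close> and \<open>b + h\<close>, with the weights interchanged; in the sum of the two
  convexity inequalities the weights cancel.\<close>

lemma convex_on_increment_mono:
  fixes f :: "real \<Rightarrow> real"
  assumes f: "convex_on S f" and S: "a \<in> S" "b + h \<in> S" and "a \<le> b" "0 < h"
  shows "f (a + h) - f a \<le> f (b + h) - f b"
proof -
  define l where "l = h / (b - a + h)"
  have l: "0 \<le> l" "l \<le> 1" using assms by (auto simp: l_def)
  have eq: "l * (b - a + h) = h" using assms by (simp add: l_def)
  have 1: "f ((1 - l) *\<^sub>R a + l *\<^sub>R (b + h)) \<le> (1 - l) * f a + l * f (b + h)"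
    by (rule convex_onD[OF f]) (use l S in auto)
  have 2: "f ((1 - (1 - l)) *\<^sub>R a + (1 - l) *\<^sub>R (b + h)) \<le> (1 - (1 - l)) * f a + (1 - l) * f (b + h)"
    by (rule convex_onD[OF f]) (use l S in auto)
  have "(1 - l) *\<^sub>R a + l *\<^sub>R (b + h) = a + h"
    using eq by (simp add: algebra_simps)
  moreover have "(1 - (1 - l)) *\<^sub>R a + (1 - l) *\<^sub>R (b + h) = b"
    using eq by (simp add: algebra_simps)
  ultimately have "f (a + h) \<le> (1 - l) * f a + l * f (b + h)" "f b \<le> l * f a + (1 - l) * f (b + h)"
    using 1 2 by auto
  then show ?thesis by (simp add: algebra_simps)
qed

text \<open>The hypotheses in the form in which they are used, stable under multiplication by a
  positive constant. \<open>ratio\<close> says, without division, that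
  \<open>\<phi> (a + h) / \<phi> a\<close> is non-decreasing in \<open>a\<close>.\<close>

locale log_convex_density =
  fixes \<phi> :: "real \<Rightarrow> real"
  assumes pos: "0 < s \<Longrightarrow> 0 < \<phi> s"
    and antimono: "0 < s \<Longrightarrow> s \<le> t \<Longrightarrow> \<phi> t \<le> \<phi> s"
    and cont: "continuous_on {0<..} \<phi>"
    and ratio: "0 < a \<Longrightarrow> a \<le> b \<Longrightarrow> 0 < h \<Longrightarrow> \<phi> (a + h) * \<phi> b \<le> \<phi> a * \<phi> (b + h)"
    and nonint: "0 < a \<Longrightarrow> (\<integral>\<^sup>+s\<in>{0<..<a}. \<phi> s \<partial>lborel) = \<infinity>"
    and int: "\<exists>a>0. (\<integral>\<^sup>+s\<in>{a..}. \<phi> s \<partial>lborel) < \<infinity>"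

lemma log_convex_densityI:
  assumes nonneg: "\<And>s. 0 < s \<Longrightarrow> 0 \<le> \<phi> s" and mono: "antimono_on {0<..} \<phi>" and lc: "log_convex \<phi>"
    and nonint: "\<And>a. 0 < a \<Longrightarrow> \<not> set_integrable lborel {0<..<a} \<phi>"
    and int: "\<exists>a>0. set_integrable lborel {a..} \<phi>"
  shows "log_convex_density \<phi>"
proof -
  \<comment> \<open>Non-integrability at the origin excludes the zero function; a single nonzero
    value then forces positivity everywhere.\<close>
  have "\<exists>y>0. \<phi> y \<noteq> 0"
  proof (rule ccontr)
    assume "\<not> ?thesis"
    then have "(\<lambda>s. indicator {0<..<1} s *\<^sub>R \<phi> s) = (\<lambda>_. 0)"
      by (auto simp: indicator_def)
    then show False using nonint[of 1] by (simp add: set_integrable_def)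
  qed
  then have pos: "0 < \<phi> s" if "0 < s" for s
    using log_convex_pos[OF nonneg lc _ _ that] by blast
  note cvx = log_convex_convex_on[OF pos lc]
  have "continuous_on {0<..} (\<lambda>s. exp (ln (\<phi> s)))"
    by (intro continuous_intros convex_on_continuous cvx) auto
  then have cont: "continuous_on {0<..} \<phi>"
    by (rule continuous_on_eq) (auto simp: pos)
  \<comment> \<open>Continuity provides the measurability needed to read failure of integrability as
    an infinite integral.\<close>
  have meas: "(\<lambda>s. indicator A s *\<^sub>R \<phi> s) \<in> borel_measurable lborel" if "A \<in> sets borel" "A \<subseteq> {0<..}" for A
    using borel_measurable_continuous_on_indicator[OF that(1) continuous_on_subset[OF cont that(2)]]
    by simp
  show ?thesis
  proof
    show "0 < \<phi> s" if "0 < s" for s by (fact pos[OF that])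
    show "\<phi> t \<le> \<phi> s" if "0 < s" "s \<le> t" for s t
      using mono that by (auto simp: monotone_on_def)
    show "continuous_on {0<..} \<phi>" by fact
    show "\<phi> (a + h) * \<phi> b \<le> \<phi> a * \<phi> (b + h)" if "0 < a" "a \<le> b" "0 < h" for a b h
    proof -
      have p: "0 < \<phi> (a + h)" "0 < \<phi> b" "0 < \<phi> a" "0 < \<phi> (b + h)" using that by (auto intro: pos)
      have "ln (\<phi> (a + h)) - ln (\<phi> a) \<le> ln (\<phi> (b + h)) - ln (\<phi> b)"
        by (rule convex_on_increment_mono[OF cvx]) (use that in auto)
      then have "ln (\<phi> (a + h) * \<phi> b) \<le> ln (\<phi> a * \<phi> (b + h))"
        using p by (simp add: ln_mult)
      then show ?thesis using p by simp
    qed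
    show "(\<integral>\<^sup>+s\<in>{0<..<a}. \<phi> s \<partial>lborel) = \<infinity>" if "0 < a" for a
    proof (rule ccontr)
      assume "\<not> ?thesis"
      then have "set_integrable lborel {0<..<a} \<phi>"
        unfolding set_integrable_def
        by (intro integrableI_nonneg meas)
          (auto simp: indicator_def top.not_eq_extremum intro: nonneg
            elim!: le_less_trans[rotated] intro!: nn_integral_mono)
      with nonint[OF that] show False by blast
    qed
    obtain a where a: "0 < a" "set_integrable lborel {a..} \<phi>" using int by blast
    then have "(\<integral>\<^sup>+s. norm (indicator {a..} s *\<^sub>R \<phi> s) \<partial>lborel) < \<infinity>"
      unfolding set_integrable_def integrable_iff_bounded by blast
    then have "(\<integral>\<^sup>+s\<in>{a..}. \<phi> s \<partial>lborel) < \<infinity>"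
      by (rule le_less_trans[rotated]) (auto intro!: nn_integral_mono simp: indicator_def intro: ennreal_leI)
    with a show "\<exists>a>0. (\<integral>\<^sup>+s\<in>{a..}. \<phi> s \<partial>lborel) < \<infinity>" by blast
  qed
qed

context log_convex_density
begin

text \<open>The cut-off keeps the density Borel measurable: nothing is known about \<phi> on the
  nonpositive reals.\<close>

definition profile_measure :: "real measure" where
  "profile_measure = density lborel (\<lambda>s. ennreal (if s \<in> {0<..} then \<phi> s else 0))"

lemma borel_measurable_profile [measurable]: "(\<lambda>s. if s \<in> {0<..} then \<phi> s else 0) \<in> borel_measurable borel"
  by (rule borel_measurable_continuous_on_if) (auto intro: cont)

lemma sets_profile_measure [measurable_cong, simp]: "sets profile_measure = sets borel"
  by (simp add: profile_measure_def)

lemma emeasure_profile_measure: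
  assumes "A \<in> sets borel" "A \<subseteq> {0<..}"
  shows "emeasure profile_measure A = (\<integral>\<^sup>+s\<in>A. \<phi> s \<partial>lborel)"
proof -
  have "(\<lambda>s. ennreal (if s \<in> {0<..} then \<phi> s else 0)) \<in> borel_measurable lborel"
    using borel_measurable_profile by measurable
  then show ?thesis
    unfolding profile_measure_def using assms
    by (subst emeasure_density) (auto intro!: nn_integral_cong simp: indicator_def)
qed

section \<open>The tail as a strictly decreasing bijection, and its inverse\<close>

lemma tail_ennreal: "0 \<le> y \<Longrightarrow> tail \<phi> (ennreal y) = emeasure profile_measure {y<..}"
proof -
  assume y: "0 \<le> y"
  then have "{s. 0 < s \<and> ennreal y < ennreal s} = {y<..}"
    by (auto simp: ennreal_less_iff)
  then show ?thesis
    using y by (simp add: tail_def emeasure_profile_measure)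
qed

lemma tail_top: "tail \<phi> \<infinity> = 0"
  by (simp add: tail_def)

lemma tail_split:
  assumes "0 \<le> y" "y \<le> z"
  shows "tail \<phi> (ennreal y) = emeasure profile_measure {y<..z} + tail \<phi> (ennreal z)"
proof -
  have "{y<..} = {y<..z} \<union> {z<..}" using assms by auto
  then show ?thesis
    using assms by (simp add: tail_ennreal plus_emeasure[symmetric] Int_def)
qed

text \<open>Together with \<open>emeasure_Ioc_le\<close> this replaces the derivative of the tail:
  on \<open>{y<..z}\<close> a non-increasing density lies between its values at the two
  ends.\<close>

lemma emeasure_Ioc_ge:
  assumes "0 \<le> y" "y \<le> z"
  shows "ennreal ((z - y) * \<phi> z) \<le> emeasure profile_measure {y<..z}"
proof (cases "y = z")
  case False
  have "ennreal ((z - y) * \<phi> z) = (\<integral>\<^sup>+s\<in>{y<..z}. ennreal (\<phi> z) \<partial>lborel)"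
    using assms False pos[of z] by (simp add: nn_integral_cmult_indicator ennreal_mult mult.commute)
  also have "\<dots> \<le> (\<integral>\<^sup>+s\<in>{y<..z}. ennreal (\<phi> s) \<partial>lborel)"
    using assms by (intro nn_integral_mono) (auto simp: indicator_def intro!: ennreal_leI antimono)
  finally show ?thesis using assms by (subst emeasure_profile_measure) auto
qed simp

lemma emeasure_Ioc_le:
  assumes "0 < y" "y \<le> z"
  shows "emeasure profile_measure {y<..z} \<le> ennreal ((z - y) * \<phi> y)"
proof -
  have "(\<integral>\<^sup>+s\<in>{y<..z}. ennreal (\<phi> s) \<partial>lborel) \<le> (\<integral>\<^sup>+s\<in>{y<..z}. ennreal (\<phi> y) \<partial>lborel)"
    using assms by (intro nn_integral_mono) (auto simp: indicator_def intro!: ennreal_leI antimono)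
  also have "\<dots> = ennreal ((z - y) * \<phi> y)"
    using assms pos[of y] by (simp add: nn_integral_cmult_indicator ennreal_mult mult.commute)
  finally show ?thesis using assms by (subst emeasure_profile_measure) auto
qed

lemma tail_finite: "0 < y \<Longrightarrow> tail \<phi> (ennreal y) < \<infinity>"
proof -
  assume y: "0 < y"
  obtain a where a: "0 < a" "(\<integral>\<^sup>+s\<in>{a..}. \<phi> s \<partial>lborel) < \<infinity>" using int by blast
  have "tail \<phi> (ennreal y) \<le> emeasure profile_measure ({y<..a} \<union> {a..})"
    using y by (auto simp: tail_ennreal intro!: emeasure_mono)
  also have "\<dots> \<le> emeasure profile_measure {y<..a} + emeasure profile_measure {a..}"
    by (intro emeasure_subadditive) auto
  also have "emeasure profile_measure {y<..a} < \<infinity>"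
    using emeasure_Ioc_le[of y a] y by (cases "y \<le> a") (auto simp: less_top[symmetric] top_unique)
  then have "emeasure profile_measure {y<..a} + emeasure profile_measure {a..} < \<infinity>"
    using a by (subst (2) emeasure_profile_measure) auto
  finally show ?thesis .
qed

lemma tail_strict_antimono:
  assumes "0 \<le> y" "y < z"
  shows "tail \<phi> (ennreal z) < tail \<phi> (ennreal y)"
proof -
  have "0 < (z - y) * \<phi> z" using assms by (simp add: pos)
  then have "0 < emeasure profile_measure {y<..z}"
    using emeasure_Ioc_ge[of y z] assms by (auto intro: order.strict_trans2[of _ "ennreal ((z - y) * \<phi> z)"])
  moreover have "tail \<phi> (ennreal z) \<noteq> \<infinity>" using tail_finite[of z] assms by simp
  ultimately have "tail \<phi> (ennreal z) + 0 < tail \<phi> (ennreal z) + emeasure profile_measure {y<..z}"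
    unfolding ennreal_add_left_cancel_less by simp
  then show ?thesis using tail_split[of y z] assms by (simp add: add.commute)
qed

lemma tail_zero: "tail \<phi> 0 = \<infinity>"
proof -
  have "\<infinity> = emeasure profile_measure {0<..<1}"
    using nonint[of 1] by (subst emeasure_profile_measure) auto
  also have "\<dots> \<le> emeasure profile_measure {0<..}"
    by (intro emeasure_mono) auto
  finally show ?thesis using tail_ennreal[of 0] by (simp add: top_unique)
qed

lemma tail_antimono: "s \<le> t \<Longrightarrow> tail \<phi> t \<le> tail \<phi> s"
  by (auto simp: tail_def indicator_def intro!: nn_integral_mono)

lemma tail_le_iff:
  assumes "0 \<le> y" "0 \<le> z"
  shows "tail \<phi> (ennreal y) \<le> tail \<phi> (ennreal z) \<longleftrightarrow> z \<le> y"
  using tail_strict_antimono[of y z] tail_antimono[of "ennreal z" "ennreal y"] assms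
  by (auto simp: not_le[symmetric] ennreal_leI)

lemma tail_surj:
  assumes "0 < m" "m < \<infinity>"
  obtains y where "0 < y" "tail \<phi> (ennreal y) = m"
proof -
  \<comment> \<open>Continuity from below at radius 0, where the tail is infinite, yields
    \<open>a\<close> with tail above \<open>m\<close>. Continuity from above at infinity, legitimate
    because tails at positive radii are finite, then yields \<open>b\<close> with tail below
    \<open>m\<close>.\<close>
  have "(SUP n. emeasure profile_measure {1 / real (Suc n) <..}) = emeasure profile_measure (\<Union>n. {1 / real (Suc n) <..})"
    by (intro SUP_emeasure_incseq) (auto simp: incseq_def frac_le order.strict_trans1[rotated])
  also have "(\<Union>n. {1 / real (Suc n) <..}) = {0<..}"
    by (auto elim!: nat_approx_posE intro: order.strict_trans2[of 0]) (metis less_trans of_nat_0_less_iff zero_less_Suc zero_less_divide_1_iff of_nat_Suc)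
  finally have "(SUP n. emeasure profile_measure {1 / real (Suc n) <..}) = \<infinity>"
    using tail_zero tail_ennreal[of 0] by simp
  then obtain n where n: "m < emeasure profile_measure {1 / real (Suc n) <..}"
    using assms less_SUP_iff[of m "\<lambda>n. emeasure profile_measure {1 / real (Suc n) <..}" UNIV] by auto
  define a where "a = 1 / real (Suc n)"
  have a: "0 < a" "m < tail \<phi> (ennreal a)" using n by (auto simp: a_def tail_ennreal)
  have "(INF n. emeasure profile_measure {real (Suc n) <..}) = emeasure profile_measure (\<Inter>n. {real (Suc n) <..})"
    by (intro INF_emeasure_decseq)
      (use tail_finite[of "real (Suc _)"] in \<open>auto simp: decseq_def tail_ennreal[symmetric] less_top simp del: of_nat_Suc\<close>)
  also have "(\<Inter>n. {real (Suc n) <..}) = {}"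
  proof -
    have "\<not> (\<forall>n. real (Suc n) < x)" for x
    proof -
      obtain n where "x < real n" using reals_Archimedean2 by blast
      then have "x < real (Suc n)" by simp
      then show ?thesis by (meson less_asym)
    qed
    then show ?thesis by auto
  qed
  finally have "(INF n. emeasure profile_measure {real (Suc n) <..}) = 0" by simp
  then obtain k where k: "emeasure profile_measure {real (Suc k) <..} < m"
    using assms INF_less_iff[of "\<lambda>n. emeasure profile_measure {real (Suc n) <..}" UNIV m] by auto
  define b where "b = real (Suc k)"
  have b: "0 < b" "tail \<phi> (ennreal b) < m" using k by (auto simp: b_def tail_ennreal simp del: of_nat_Suc)
  define G where "G y = enn2real (tail \<phi> (ennreal y))" for y
  have G: "tail \<phi> (ennreal y) = ennreal (G y)" if "0 < y" for y
    using tail_finite[OF that] by (simp add: G_def less_top)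
  have ab: "a < b"
    using tail_le_iff[of a b] a b order.strict_trans[OF b(2) a(2)] by (simp add: not_le[symmetric])
  \<comment> \<open>The density is at most \<open>\<phi> a\<close> beyond \<open>a\<close>, which
    makes \<open>\<phi> a\<close> a Lipschitz constant for the tail on \<open>{a..b}\<close>;
    continuity and the intermediate value theorem follow.\<close>
  have bound: "G y \<le> G z + \<phi> a * (z - y)" "G z \<le> G y" if "a \<le> y" "y \<le> z" for y z
  proof -
    have "ennreal (G y) \<le> ennreal ((z - y) * \<phi> y) + ennreal (G z)"
      using tail_split[of y z] emeasure_Ioc_le[of y z] a that by (auto simp: G[symmetric] intro!: add_right_mono)
    also have "\<dots> \<le> ennreal ((z - y) * \<phi> a) + ennreal (G z)"
      using that a by (intro add_right_mono ennreal_leI mult_left_mono antimono) auto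
    also have "\<dots> = ennreal ((z - y) * \<phi> a + G z)"
      using that a pos[of a] by (intro ennreal_plus[symmetric]) (auto simp: G_def)
    finally show "G y \<le> G z + \<phi> a * (z - y)"
      using that a pos[of a] by (subst (asm) ennreal_le_iff) (auto simp: G_def mult.commute add.commute)
    show "G z \<le> G y"
      using tail_antimono[OF ennreal_leI[OF that(2)]] tail_finite[of y] that a
      unfolding G_def by (intro enn2real_mono) auto
  qed
  have sym: "\<bar>G x - G y\<bar> \<le> \<phi> a * \<bar>x - y\<bar>" if "a \<le> x" "a \<le> y" "x \<le> y" for x y
    using bound[of x y] that by simp
  have "(\<phi> a)-lipschitz_on {a..b} G"
  proof (rule lipschitz_onI)
    fix x y assume xy: "x \<in> {a..b}" "y \<in> {a..b}"
    show "dist (G x) (G y) \<le> \<phi> a * dist x y"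
    proof (cases "x \<le> y")
      case True
      then show ?thesis using sym[of x y] xy by (simp add: dist_real_def)
    next
      case False
      then show ?thesis using sym[of y x] xy by (simp add: dist_real_def abs_minus_commute)
    qed
  qed (use pos a in \<open>auto intro: less_imp_le\<close>)
  then have "continuous_on {a..b} G" by (rule lipschitz_on_continuous_on)
  moreover have "G b \<le> enn2real m" "enn2real m \<le> G a"
    using a b assms tail_finite[of a] tail_finite[of b] by (auto simp: G_def intro!: enn2real_mono)
  ultimately obtain y where y: "a \<le> y" "y \<le> b" "G y = enn2real m"
    using IVT2'[of G b "enn2real m" a] ab by auto
  show ?thesis
    by (rule that[of y]) (use y a assms G[of y] in \<open>auto simp: less_top\<close>)
qed

lemma tail_pos: "0 \<le> y \<Longrightarrow> tail \<phi> (ennreal y) \<noteq> 0"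
  using tail_strict_antimono[of y "y + 1"] by auto

lemma tail_inv_tail:
  assumes "0 < y"
  shows "tail_inv \<phi> (tail \<phi> (ennreal y)) = ennreal y"
proof -
  have "(THE t. tail \<phi> t = tail \<phi> (ennreal y)) = ennreal y"
  proof (rule the_equality)
    fix t assume t: "tail \<phi> t = tail \<phi> (ennreal y)"
    show "t = ennreal y"
    proof (cases t)
      case (real x)
      then show ?thesis using t tail_le_iff[of x y] tail_le_iff[of y x] assms by auto
    next
      case top
      then show ?thesis using t tail_pos[of y] tail_top assms by auto
    qed
  qed simp
  then show ?thesis using tail_pos[of y] assms by (simp add: tail_inv_def)
qed

text \<open>A positive density has a nonzero tail at every finite radius, so the support of the tail
  is not compact.\<close>

lemma tail_inv_zero: "tail_inv \<phi> 0 = \<infinity>"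
proof -
  have "ennreal (real n) \<le> Sup {t. tail \<phi> t \<noteq> 0}" for n
    by (intro Sup_upper) (auto simp: tail_pos)
  then have "(SUP n. of_nat n) \<le> Sup {t. tail \<phi> t \<noteq> 0}"
    by (intro SUP_least) (simp add: ennreal_of_nat_eq_real_of_nat)
  then show ?thesis by (simp add: tail_inv_def ennreal_SUP_of_nat_eq_top top_unique)
qed

end

lemma (in log_convex_density) log_convex_density_cmult:
  assumes c: "0 < c"
  shows "log_convex_density (\<lambda>s. c * \<phi> s)"
proof
  \<comment> \<open>The integrand is exchanged for its cut-off version on \<open>A\<close>, which is
    measurable, before the constant is pulled out.\<close>
  have cmult: "(\<integral>\<^sup>+s\<in>A. ennreal (c * \<phi> s) \<partial>lborel) = ennreal c * (\<integral>\<^sup>+s\<in>A. ennreal (\<phi> s) \<partial>lborel)"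
    if [measurable]: "A \<in> sets borel" and A: "A \<subseteq> {0<..}" for A
  proof -
    have "(\<integral>\<^sup>+s\<in>A. ennreal (c * \<phi> s) \<partial>lborel) =
        (\<integral>\<^sup>+s. ennreal c * (ennreal (if s \<in> {0<..} then \<phi> s else 0) * indicator A s) \<partial>lborel)"
      using A c by (intro nn_integral_cong) (auto simp: indicator_def ennreal_mult')
    also have "\<dots> = ennreal c * (\<integral>\<^sup>+s. ennreal (if s \<in> {0<..} then \<phi> s else 0) * indicator A s \<partial>lborel)"
      using borel_measurable_profile by (intro nn_integral_cmult) measurable
    also have "(\<integral>\<^sup>+s. ennreal (if s \<in> {0<..} then \<phi> s else 0) * indicator A s \<partial>lborel) = (\<integral>\<^sup>+s\<in>A. ennreal (\<phi> s) \<partial>lborel)"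
      using A by (intro nn_integral_cong) (auto simp: indicator_def)
    finally show ?thesis .
  qed
  show "0 < c * \<phi> s" if "0 < s" for s using c pos that by simp
  show "c * \<phi> t \<le> c * \<phi> s" if "0 < s" "s \<le> t" for s t using c antimono[OF that] by simp
  show "continuous_on {0<..} (\<lambda>s. c * \<phi> s)" by (intro continuous_intros cont)
  show "c * \<phi> (a + h) * (c * \<phi> b) \<le> c * \<phi> a * (c * \<phi> (b + h))" if "0 < a" "a \<le> b" "0 < h" for a b h
    using mult_left_mono[OF ratio[OF that], of "c * c"] c by (simp add: mult_ac)
  show "(\<integral>\<^sup>+s\<in>{0<..<a}. ennreal (c * \<phi> s) \<partial>lborel) = \<infinity>" if "0 < a" for a
    using nonint[OF that] c by (subst cmult) (auto simp: ennreal_mult_top)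
  obtain a where "0 < a" "(\<integral>\<^sup>+s\<in>{a..}. \<phi> s \<partial>lborel) < \<infinity>" using int by blast
  then have "(\<integral>\<^sup>+s\<in>{a..}. ennreal (c * \<phi> s) \<partial>lborel) < \<infinity>"
    by (subst cmult) (auto simp: ennreal_mult_less_top)
  with \<open>0 < a\<close> show "\<exists>a>0. (\<integral>\<^sup>+s\<in>{a..}. ennreal (c * \<phi> s) \<partial>lborel) < \<infinity>" by blast
qed

lemma (in log_convex_density) tail_tail_inv:
  assumes "m < \<infinity>"
  shows "tail \<phi> (tail_inv \<phi> m) = m"
proof (cases "m = 0")
  case False
  then obtain y where "0 < y" "tail \<phi> (ennreal y) = m"
    using tail_surj[of m] assms by (auto simp: zero_less_iff_neq_zero)
  then show ?thesis using tail_inv_tail by auto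
qed (simp add: tail_inv_zero tail_top[simplified])

section \<open>Integration in polar coordinates of a star-shaped domain\<close>

lemma nn_integral_lebesgue_scale:
  fixes f :: "real ^ 'n \<Rightarrow> ennreal"
  assumes f: "f \<in> borel_measurable lebesgue" and s: "0 < s"
  shows "(\<integral>\<^sup>+x. f x \<partial>lebesgue) = ennreal (s ^ CARD('n)) * (\<integral>\<^sup>+x. f (s *\<^sub>R x) \<partial>lebesgue)"
proof -
  \<comment> \<open>The affine change of variables takes one factor per coordinate. With all factors
    equal to \<open>s\<close> it is a homothety, and the product of the factors is s^n.\<close>
  have T: "(\<lambda>x::real^'n. 0 + (\<Sum>j\<in>Basis. (s * (x \<bullet> j)) *\<^sub>R j)) = (\<lambda>x. s *\<^sub>R x)"
  proof
    fix x :: "real ^ 'n"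
    have "(\<Sum>j\<in>Basis. (s * (x \<bullet> j)) *\<^sub>R j) = s *\<^sub>R (\<Sum>j\<in>Basis. (x \<bullet> j) *\<^sub>R j)"
      by (simp add: scaleR_sum_right)
    then show "0 + (\<Sum>j\<in>Basis. (s * (x \<bullet> j)) *\<^sub>R j) = s *\<^sub>R x"
      by (simp add: euclidean_representation)
  qed
  have eq: "lebesgue = density (distr lebesgue lebesgue (\<lambda>x::real^'n. s *\<^sub>R x)) (\<lambda>_. ennreal (s ^ CARD('n)))"
    using lebesgue_affine_euclidean[of "\<lambda>_::real^'n. s" 0] s unfolding T by simp
  have meas: "(\<lambda>x::real^'n. s *\<^sub>R x) \<in> lebesgue \<rightarrow>\<^sub>M lebesgue"
    using lebesgue_affine_measurable[of "\<lambda>_::real^'n. s" 0] s unfolding T by simp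
  have "(\<integral>\<^sup>+x. f x \<partial>lebesgue) = (\<integral>\<^sup>+x. ennreal (s ^ CARD('n)) * f x \<partial>distr lebesgue lebesgue (\<lambda>x. s *\<^sub>R x))"
    by (subst eq, subst nn_integral_density) (use f in auto)
  also have "\<dots> = ennreal (s ^ CARD('n)) * (\<integral>\<^sup>+x. f x \<partial>distr lebesgue lebesgue (\<lambda>x. s *\<^sub>R x))"
    by (rule nn_integral_cmult) (use f in simp)
  also have "(\<integral>\<^sup>+x. f x \<partial>distr lebesgue lebesgue (\<lambda>x. s *\<^sub>R x)) = (\<integral>\<^sup>+x. f (s *\<^sub>R x) \<partial>lebesgue)"
    by (rule nn_integral_distr[OF meas]) (use f in simp)
  finally show ?thesis .
qed

locale weighted_star_domain =
  fixes B :: "(real ^ 'n) set" and \<rho> w :: "real ^ 'n \<Rightarrow> real"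
  assumes star: "star_shaped_domain B \<rho>"
    and weight_measurable: "w \<in> borel_measurable lebesgue"
    and weight_nonneg: "0 \<le> w x"
    and weight_homogeneous: "one_homogeneous w"
    and weight_integrable: "set_integrable lebesgue B w"
begin

abbreviation N :: "real ^ 'n \<Rightarrow> real" where "N \<equiv> star_norm \<rho>"

text \<open>The point with \<open>N = 1\<close> on the ray through \<open>x\<close>; at the origin
  the value is 0.\<close>

definition dir :: "real ^ 'n \<Rightarrow> real ^ 'n" where "dir x = x /\<^sub>R N x"

section \<open>The gauge of the star-shaped domain\<close>

lemma rho_pos: "x \<noteq> 0 \<Longrightarrow> 0 < \<rho> (sgn x)"
  using star by (auto simp: star_shaped_domain_def norm_sgn)

lemma N_zero [simp]: "N 0 = 0"
  by (simp add: star_norm_def)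

lemma N_pos: "x \<noteq> 0 \<Longrightarrow> 0 < N x"
  using rho_pos by (simp add: star_norm_def)

lemma N_nonneg: "0 \<le> N x"
  using N_pos[of x] by (cases "x = 0") auto

lemma N_eq_0_iff [simp]: "N x = 0 \<longleftrightarrow> x = 0"
  using N_pos[of x] by (cases "x = 0") auto

lemma N_scaleR: "0 \<le> s \<Longrightarrow> N (s *\<^sub>R x) = s * N x"
  by (cases "s = 0") (auto simp: star_norm_def sgn_scaleR)

lemma mem_domain_iff: "x \<in> B \<longleftrightarrow> N x < 1"
proof -
  have B: "B = {r *\<^sub>R \<theta> | r \<theta>. \<theta> \<in> sphere 0 1 \<and> 0 \<le> r \<and> r < \<rho> \<theta>}"
    and \<rho>: "\<And>\<theta>. \<theta> \<in> sphere 0 1 \<Longrightarrow> 0 < \<rho> \<theta>"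
    using star by (auto simp: star_shaped_domain_def)
  show ?thesis
  proof (cases "x = 0")
    case True
    \<comment> \<open>The origin has no direction of its own; it is the point of radius 0 on an
      arbitrary ray.\<close>
    obtain \<theta> :: "real ^ 'n" where "norm \<theta> = 1" using vector_choose_size[of 1] by auto
    then have "0 \<in> B"
      unfolding B using \<rho>[of \<theta>] by (auto intro!: exI[of _ "0::real"] exI[of _ \<theta>])
    then show ?thesis using True by simp
  next
    case False
    show ?thesis
    proof
      assume "x \<in> B"
      then obtain r \<theta> where r: "x = r *\<^sub>R \<theta>" "norm \<theta> = 1" "0 \<le> r" "r < \<rho> \<theta>" unfolding B by auto
      with False have "0 < r" by (cases "r = 0") auto
      then have "sgn x = \<theta>" using r by (simp add: sgn_div_norm)
      then show "N x < 1" using r \<open>0 < r\<close> by (simp add: star_norm_def)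
    next
      assume "N x < 1"
      then have "norm x < \<rho> (sgn x)" using rho_pos[OF False] by (simp add: star_norm_def)
      moreover have "x = norm x *\<^sub>R sgn x" using False by (simp add: sgn_div_norm)
      ultimately show "x \<in> B"
        unfolding B using False by (auto simp: norm_sgn intro!: exI[of _ "norm x"] exI[of _ "sgn x"])
    qed
  qed
qed

lemma scaled_domain: "0 < t \<Longrightarrow> (*\<^sub>R) t ` B = {x. N x < t}"
proof (safe)
  fix x assume t: "0 < t" and x: "N x < t"
  show "x \<in> (*\<^sub>R) t ` B"
    by (rule image_eqI[of _ _ "x /\<^sub>R t"]) (use t x in \<open>auto simp: mem_domain_iff N_scaleR field_simps\<close>)
qed (auto simp: mem_domain_iff N_scaleR)

lemma N_measurable [measurable]: "N \<in> borel_measurable borel"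
proof -
  \<comment> \<open>Measurability of \<rho> is given on the sphere only; extension by 0 makes it
    global. At \<open>x = 0\<close> the numerator vanishes, so \<open>N\<close> is
    unchanged.\<close>
  define \<rho>' where "\<rho>' = (\<lambda>x. indicator (sphere 0 1) x *\<^sub>R \<rho> x)"
  have [measurable]: "\<rho>' \<in> borel_measurable borel"
    unfolding \<rho>'_def using star
    by (subst borel_measurable_restrict_space_iff[symmetric]) (auto simp: star_shaped_domain_def)
  have "N = (\<lambda>x. norm x / \<rho>' (sgn x))"
    by (auto simp: fun_eq_iff star_norm_def \<rho>'_def norm_sgn indicator_def)
  then show ?thesis by simp
qed

lemma dir_measurable [measurable]: "dir \<in> borel_measurable borel"
  unfolding dir_def by measurable

lemma dir_scaleR: "0 < s \<Longrightarrow> dir (s *\<^sub>R x) = dir x"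
  by (simp add: dir_def N_scaleR)

lemma N_dir: "x \<noteq> 0 \<Longrightarrow> N (dir x) = 1"
  using N_pos[of x] by (simp add: dir_def N_scaleR)

lemma N_scaleR_dir: "N x *\<^sub>R dir x = x"
  by (cases "x = 0") (auto simp: dir_def)

section \<open>Polar decomposition of the weighted Lebesgue measure\<close>

definition weight_measure :: "(real ^ 'n) measure" where
  "weight_measure = distr (density lebesgue (\<lambda>x. ennreal (w x))) borel (\<lambda>x. x)"

lemma sets_weight_measure [measurable_cong, simp]: "sets weight_measure = sets borel"
  and space_weight_measure [simp]: "space weight_measure = UNIV"
  by (simp_all add: weight_measure_def)

lemma borel_measurable_weight_times:
  assumes "f \<in> borel_measurable borel"
  shows "(\<lambda>x. ennreal (w x) * f x) \<in> borel_measurable lebesgue"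
proof -
  have "f \<in> borel_measurable lebesgue" using assms by (intro measurable_completion) simp
  then show ?thesis using weight_measurable by simp
qed

lemma nn_integral_weight_measure:
  assumes f: "f \<in> borel_measurable borel"
  shows "integral\<^sup>N weight_measure f = (\<integral>\<^sup>+x. ennreal (w x) * f x \<partial>lebesgue)"
proof -
  have id: "(\<lambda>x. x) \<in> lebesgue \<rightarrow>\<^sub>M borel" by (intro measurable_completion) simp
  have "integral\<^sup>N weight_measure f = integral\<^sup>N (density lebesgue (\<lambda>x. ennreal (w x))) f"
    unfolding weight_measure_def using f id by (subst nn_integral_distr) auto
  also have "\<dots> = (\<integral>\<^sup>+x. ennreal (w x) * f x \<partial>lebesgue)"
    using weight_measurable f by (intro nn_integral_density) (auto intro: measurable_completion)
  finally show ?thesis .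
qed

text \<open>The exponent n + 1 is made of n from Lebesgue measure and 1 from the homogeneity of
  \<open>w\<close>.\<close>

lemma nn_integral_weight_measure_scale:
  assumes f: "f \<in> borel_measurable borel" and s: "0 < s"
  shows "integral\<^sup>N weight_measure f = ennreal (s ^ Suc CARD('n)) * (\<integral>\<^sup>+x. f (s *\<^sub>R x) \<partial>weight_measure)"
proof -
  have f': "(\<lambda>x. f (s *\<^sub>R x)) \<in> borel_measurable borel" using f by measurable
  have wf: "(\<lambda>x. ennreal (w x) * f (s *\<^sub>R x)) \<in> borel_measurable lebesgue"
    by (rule borel_measurable_weight_times[OF f'])
  have w: "ennreal (w (s *\<^sub>R x)) = ennreal s * ennreal (w x)" for x
    using weight_homogeneous s weight_nonneg by (simp add: one_homogeneous_def ennreal_mult)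
  have "integral\<^sup>N weight_measure f = (\<integral>\<^sup>+x. ennreal (w x) * f x \<partial>lebesgue)"
    by (rule nn_integral_weight_measure[OF f])
  also have "\<dots> = ennreal (s ^ CARD('n)) * (\<integral>\<^sup>+x. ennreal (w (s *\<^sub>R x)) * f (s *\<^sub>R x) \<partial>lebesgue)"
    by (rule nn_integral_lebesgue_scale[OF borel_measurable_weight_times[OF f] s])
  also have "(\<integral>\<^sup>+x. ennreal (w (s *\<^sub>R x)) * f (s *\<^sub>R x) \<partial>lebesgue) =
      ennreal s * (\<integral>\<^sup>+x. ennreal (w x) * f (s *\<^sub>R x) \<partial>lebesgue)"
    unfolding w mult.assoc by (rule nn_integral_cmult[OF wf])
  also have "(\<integral>\<^sup>+x. ennreal (w x) * f (s *\<^sub>R x) \<partial>lebesgue) = (\<integral>\<^sup>+x. f (s *\<^sub>R x) \<partial>weight_measure)"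
    by (rule nn_integral_weight_measure[OF f', symmetric])
  finally show ?thesis using s by (simp add: ennreal_mult mult.assoc mult.left_commute)
qed

lemma domain_borel [measurable]: "B \<in> sets borel"
  using star unfolding star_shaped_domain_def by blast

lemma emeasure_weight_domain: "ennreal (real CARD('n) + 1) * emeasure weight_measure B = ennreal (weight_const B w)"
proof -
  have "emeasure weight_measure B = integral\<^sup>N weight_measure (indicator B)"
    by simp
  also have "\<dots> = (\<integral>\<^sup>+x. ennreal (w x) * indicator B x \<partial>lebesgue)"
    by (rule nn_integral_weight_measure) simp
  also have "\<dots> = (\<integral>\<^sup>+x. ennreal (indicator B x *\<^sub>R w x) \<partial>lebesgue)"
    by (intro nn_integral_cong) (auto simp: indicator_def)
  also have "\<dots> = ennreal (LINT x:B|lebesgue. w x)"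
    unfolding set_lebesgue_integral_def
    using weight_integrable weight_nonneg
    by (intro nn_integral_eq_integral) (auto simp: set_integrable_def)
  moreover have "0 \<le> (LINT x:B|lebesgue. w x)"
    unfolding set_lebesgue_integral_def using weight_nonneg by (intro integral_nonneg_AE) auto
  ultimately show ?thesis by (simp add: weight_const_def ennreal_mult)
qed

text \<open>The cone measure of \<open>B\<close>, carried by the set \<open>N = 1\<close> instead of
  the Euclidean sphere. The factor n + 1 offsets the integral of r^n over (0, 1), so that the polar
  formula has no constant and the total mass is \<open>weight_const B w\<close>.\<close>

definition cone_measure :: "(real ^ 'n) measure" where
  "cone_measure = distr (density weight_measure (\<lambda>x. ennreal (real CARD('n) + 1) * indicator B x)) borel dir"

lemma sets_cone_measure [measurable_cong, simp]: "sets cone_measure = sets borel"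
  and space_cone_measure [simp]: "space cone_measure = UNIV"
  by (simp_all add: cone_measure_def)

lemma emeasure_cone_measure:
  assumes [measurable]: "\<Theta> \<in> sets borel"
  shows "emeasure cone_measure \<Theta> = ennreal (real CARD('n) + 1) * emeasure weight_measure {x. dir x \<in> \<Theta> \<and> N x < 1}"
proof -
  have [simp]: "dir -` \<Theta> \<in> sets borel" by (rule measurable_sets_borel[OF dir_measurable assms])
  have "emeasure cone_measure \<Theta> = emeasure (density weight_measure (\<lambda>x. ennreal (real CARD('n) + 1) * indicator B x)) (dir -` \<Theta>)"
    unfolding cone_measure_def by (subst emeasure_distr) auto
  also have "\<dots> = (\<integral>\<^sup>+x. ennreal (real CARD('n) + 1) * indicator {x. dir x \<in> \<Theta> \<and> N x < 1} x \<partial>weight_measure)"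
    by (subst emeasure_density) (auto intro!: nn_integral_cong simp: indicator_def mem_domain_iff)
  also have "\<dots> = ennreal (real CARD('n) + 1) * emeasure weight_measure {x. dir x \<in> \<Theta> \<and> N x < 1}"
    by (rule nn_integral_cmult_indicator) simp
  finally show ?thesis .
qed

lemma emeasure_cone_measure_UNIV: "emeasure cone_measure UNIV = ennreal (weight_const B w)"
  using emeasure_weight_domain
  by (simp add: emeasure_cone_measure mem_domain_iff[symmetric])

lemma finite_cone_measure: "finite_measure cone_measure"
  by (rule finite_measureI) (simp add: emeasure_cone_measure_UNIV)

lemma emeasure_weight_measure_zero: "emeasure weight_measure {0} = 0"
proof -
  have "emeasure weight_measure {0} = integral\<^sup>N weight_measure (indicator {0})" by simp
  also have "\<dots> = (\<integral>\<^sup>+x. ennreal (w x) * indicator {0} x \<partial>lebesgue)"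
    by (rule nn_integral_weight_measure) simp
  also have "\<dots> = 0"
    unfolding nn_integral_completion
    by (rule nn_integral_null_set) (simp add: finite_imp_null_set_lborel)
  finally show ?thesis .
qed

lemma AE_cone_measure_N: "AE \<theta> in cone_measure. N \<theta> = 1"
proof (rule AE_I)
  show "emeasure cone_measure {\<theta>. N \<theta> \<noteq> 1} = 0"
  proof -
    \<comment> \<open>\<open>dir\<close> misses the set \<open>N = 1\<close> only at the origin,
      which is a null set.\<close>
    have "emeasure weight_measure {x. N (dir x) \<noteq> 1 \<and> N x < 1} \<le> emeasure weight_measure {0}"
      using N_dir by (intro emeasure_mono) auto
    then show ?thesis
      by (subst emeasure_cone_measure) (auto simp: emeasure_weight_measure_zero)
  qed
qed auto

text \<open>The exponent is n instead of the usual n - 1 because the weight contributes one power of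
  the radius.\<close>

definition radius_measure :: "real measure" where
  "radius_measure = density lborel (\<lambda>s. ennreal (s ^ CARD('n)) * indicator {0<..} s)"

lemma sets_radius_measure [measurable_cong, simp]: "sets radius_measure = sets borel"
  and space_radius_measure [simp]: "space radius_measure = UNIV"
  by (simp_all add: radius_measure_def)

lemma emeasure_radius_measure_lessThan:
  "0 < s \<Longrightarrow> emeasure radius_measure {..<s} = ennreal (s ^ Suc CARD('n) / (real CARD('n) + 1))"
  "s \<le> 0 \<Longrightarrow> emeasure radius_measure {..<s} = 0"
proof -
  have eq: "emeasure radius_measure {..<s} = (\<integral>\<^sup>+r. ennreal (r ^ CARD('n)) * indicator {0<..<s} r \<partial>lborel)" for s
    unfolding radius_measure_def
    by (subst emeasure_density) (auto intro!: nn_integral_cong simp: indicator_def)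
  {
    assume s: "0 < s"
    have "(\<integral>\<^sup>+r. ennreal (r ^ CARD('n)) * indicator {0<..<s} r \<partial>lborel) =
        (\<integral>\<^sup>+r. ennreal (r ^ CARD('n)) * indicator {0..s} r \<partial>lborel)"
      by (rule nn_integral_cong_AE)
        (use AE_lborel_singleton[of 0] AE_lborel_singleton[of s] in \<open>eventually_elim, auto simp: indicator_def\<close>)
    also have "\<dots> = ennreal (s ^ Suc CARD('n) / (real CARD('n) + 1) - 0 ^ Suc CARD('n) / (real CARD('n) + 1))"
    proof (rule nn_integral_FTC_Icc)
      show "((\<lambda>r. r ^ Suc CARD('n) / (real CARD('n) + 1)) has_real_derivative r ^ CARD('n)) (at r)" for r
        using DERIV_cdivide[OF DERIV_pow[of "Suc CARD('n)" r], of "real CARD('n) + 1"]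
        by (simp add: add.commute add_nonneg_eq_0_iff)
    qed (use s in auto)
    finally show "emeasure radius_measure {..<s} = ennreal (s ^ Suc CARD('n) / (real CARD('n) + 1))"
      by (simp add: eq)
  }
  show "emeasure radius_measure {..<s} = 0" if "s \<le> 0"
    using that by (simp add: eq)
qed

text \<open>The sector of radius \<open>s\<close> is the dilate by \<open>s\<close> of the sector of
  radius 1, so the scaling law reduces everything to \<open>s = 1\<close>, which is the definition
  of the cone measure.\<close>

lemma emeasure_cone_sector:
  assumes [measurable]: "\<Theta> \<in> sets borel"
  shows "emeasure weight_measure {x. dir x \<in> \<Theta> \<and> N x < s} = emeasure cone_measure \<Theta> * emeasure radius_measure {..<s}"
proof (cases "0 < s")
  case True
  let ?E = "\<lambda>s. {x. dir x \<in> \<Theta> \<and> N x < s}"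
  have "emeasure weight_measure (?E s) = integral\<^sup>N weight_measure (indicator (?E s))"
    by simp
  also have "\<dots> = ennreal (s ^ Suc CARD('n)) * (\<integral>\<^sup>+x. indicator (?E s) (s *\<^sub>R x) \<partial>weight_measure)"
    by (rule nn_integral_weight_measure_scale[OF _ True]) simp
  also have "(\<integral>\<^sup>+x. indicator (?E s) (s *\<^sub>R x) \<partial>weight_measure) = (\<integral>\<^sup>+x. indicator (?E 1) x \<partial>weight_measure)"
    using True by (intro nn_integral_cong) (auto simp: indicator_def dir_scaleR N_scaleR)
  also have "\<dots> = emeasure weight_measure (?E 1)" by simp
  finally have *: "emeasure weight_measure (?E s) = ennreal (s ^ Suc CARD('n)) * emeasure weight_measure (?E 1)" .
  have "s ^ Suc CARD('n) = (real CARD('n) + 1) * (s ^ Suc CARD('n) / (real CARD('n) + 1))"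
    by (simp add: add_nonneg_eq_0_iff)
  then have "ennreal (s ^ Suc CARD('n)) = ennreal (real CARD('n) + 1) * ennreal (s ^ Suc CARD('n) / (real CARD('n) + 1))"
    using True by (metis ennreal_mult' add_nonneg_nonneg of_nat_0_le_iff zero_le_one)
  then show ?thesis
    using True by (simp add: * emeasure_cone_measure emeasure_radius_measure_lessThan mult.assoc mult.left_commute mult.commute)
next
  case False
  then have "{x. dir x \<in> \<Theta> \<and> N x < s} = {}" using N_nonneg by (metis (mono_tags, lifting) Collect_empty_eq dual_order.trans linorder_not_less)
  then show ?thesis using False by (simp add: emeasure_radius_measure_lessThan del: Collect_empty_eq)
qed

lemma sigma_finite_radius_measure: "sigma_finite_measure radius_measure"
proof
  have "emeasure radius_measure {..<real n} \<noteq> \<infinity>" for n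
    using emeasure_radius_measure_lessThan[of "real n"] by (cases "n = 0") auto
  moreover have "(\<Union>n. {..<real n}) = UNIV" using reals_Archimedean2 by auto
  ultimately show "\<exists>A. countable A \<and> A \<subseteq> sets radius_measure \<and> \<Union> A = space radius_measure \<and> (\<forall>a\<in>A. emeasure radius_measure a \<noteq> \<infinity>)"
    by (intro exI[of _ "range (\<lambda>n. {..<real n})"]) auto
qed

text \<open>For fixed \<Theta> both sides are measures in \<open>J\<close>. They agree on the
  half-lines \<open>{..<s}\<close>, an intersection-stable generator, and are finite on
  \<open>{..<real n}\<close>, hence they coincide.\<close>

lemma emeasure_cone_section:
  assumes [measurable]: "\<Theta> \<in> sets borel" "J \<in> sets borel"
  shows "emeasure weight_measure {x. dir x \<in> \<Theta> \<and> N x \<in> J} = emeasure cone_measure \<Theta> * emeasure radius_measure J"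
proof -
  define M where "M = distr (density weight_measure (indicator {x. dir x \<in> \<Theta>})) borel N"
  have M: "emeasure M J = emeasure weight_measure {x. dir x \<in> \<Theta> \<and> N x \<in> J}" if [measurable]: "J \<in> sets borel" for J
  proof -
    have [simp]: "N -` J \<in> sets borel" by (rule measurable_sets_borel[OF N_measurable that])
    have "emeasure M J = emeasure (density weight_measure (indicator {x. dir x \<in> \<Theta>})) (N -` J)"
      unfolding M_def by (subst emeasure_distr) auto
    also have "\<dots> = (\<integral>\<^sup>+x. indicator {x. dir x \<in> \<Theta>} x * indicator (N -` J) x \<partial>weight_measure)"
      by (rule emeasure_density) auto
    also have "\<dots> = (\<integral>\<^sup>+x. indicator {x. dir x \<in> \<Theta> \<and> N x \<in> J} x \<partial>weight_measure)"
      by (intro nn_integral_cong) (auto split: split_indicator)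
    also have "\<dots> = emeasure weight_measure {x. dir x \<in> \<Theta> \<and> N x \<in> J}"
      by (rule nn_integral_indicator) simp
    finally show ?thesis .
  qed
  interpret C: finite_measure cone_measure by (rule finite_cone_measure)
  have "M = scale_measure (emeasure cone_measure \<Theta>) radius_measure"
  proof (rule measure_eqI_generator_eq[where E = "range lessThan" and \<Omega> = UNIV and A = "\<lambda>n. {..<real n}"])
    show "Int_stable (range (lessThan :: real \<Rightarrow> _))"
    proof (clarsimp simp: Int_stable_def)
      fix a b :: real
      have "{..<a} \<inter> {..<b} = {..<min a b}" by auto
      then show "{..<a} \<inter> {..<b} \<in> range lessThan" by blast
    qed
    show "emeasure M X = emeasure (scale_measure (emeasure cone_measure \<Theta>) radius_measure) X"
      if "X \<in> range lessThan" for X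
      using that emeasure_cone_sector[of \<Theta>] by (auto simp: M)
    show "emeasure M {..<real n} \<noteq> \<infinity>" for n
      using emeasure_cone_sector[of \<Theta> "real n"] emeasure_radius_measure_lessThan[of "real n"] C.emeasure_finite[of \<Theta>]
      by (cases "n = 0") (auto simp: M ennreal_mult_eq_top_iff)
    show "sets M = sigma_sets UNIV (range lessThan)"
      "sets (scale_measure (emeasure cone_measure \<Theta>) radius_measure) = sigma_sets UNIV (range lessThan)"
      by (simp_all add: M_def borel_Iio)
    show "(\<Union>n. {..<real n}) = UNIV" using reals_Archimedean2 by auto
  qed auto
  then have "emeasure M J = emeasure cone_measure \<Theta> * emeasure radius_measure J"
    by simp
  then show ?thesis by (simp add: M)
qed

lemma distr_weight_measure_polar:
  "distr weight_measure (cone_measure \<Otimes>\<^sub>M radius_measure) (\<lambda>x. (dir x, N x)) = cone_measure \<Otimes>\<^sub>M radius_measure"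
proof (rule sym, rule pair_measure_eqI)
  interpret C: finite_measure cone_measure by (rule finite_cone_measure)
  show "sigma_finite_measure cone_measure" ..
  show "sigma_finite_measure radius_measure" by (rule sigma_finite_radius_measure)
  fix \<Theta> J assume A: "\<Theta> \<in> sets cone_measure" "J \<in> sets radius_measure"
  have "\<Theta> \<times> J \<in> sets (cone_measure \<Otimes>\<^sub>M radius_measure)" using A by (rule pair_measureI)
  then have "emeasure (distr weight_measure (cone_measure \<Otimes>\<^sub>M radius_measure) (\<lambda>x. (dir x, N x))) (\<Theta> \<times> J) =
      emeasure weight_measure {x. dir x \<in> \<Theta> \<and> N x \<in> J}"
    by (subst emeasure_distr) (auto intro!: arg_cong2[where f=emeasure])
  then show "emeasure cone_measure \<Theta> * emeasure radius_measure J =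
      emeasure (distr weight_measure (cone_measure \<Otimes>\<^sub>M radius_measure) (\<lambda>x. (dir x, N x))) (\<Theta> \<times> J)"
    using A by (simp add: emeasure_cone_section)
qed simp

lemma nn_integral_polar:
  assumes g: "(\<lambda>(\<theta>, r). g \<theta> r) \<in> borel_measurable (borel \<Otimes>\<^sub>M borel)"
  shows "(\<integral>\<^sup>+x. g (dir x) (N x) \<partial>weight_measure) =
    (\<integral>\<^sup>+\<theta>. (\<integral>\<^sup>+r\<in>{0<..}. ennreal (r ^ CARD('n)) * g \<theta> r \<partial>lborel) \<partial>cone_measure)"
proof -
  interpret R: sigma_finite_measure radius_measure by (rule sigma_finite_radius_measure)
  have g' [measurable]: "(\<lambda>(\<theta>, r). g \<theta> r) \<in> borel_measurable (cone_measure \<Otimes>\<^sub>M radius_measure)"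
    using g by (simp cong: measurable_cong_sets)
  have [measurable]: "(\<lambda>r. g \<theta> r) \<in> borel_measurable borel" for \<theta>
    using measurable_compose[OF measurable_Pair1' g, of \<theta>] by simp
  have radial: "(\<integral>\<^sup>+r. g \<theta> r \<partial>radius_measure) = (\<integral>\<^sup>+r\<in>{0<..}. ennreal (r ^ CARD('n)) * g \<theta> r \<partial>lborel)" for \<theta>
    unfolding radius_measure_def
    by (subst nn_integral_density) (auto intro!: nn_integral_cong simp: indicator_def)
  have "(\<integral>\<^sup>+x. g (dir x) (N x) \<partial>weight_measure) =
      integral\<^sup>N (distr weight_measure (cone_measure \<Otimes>\<^sub>M radius_measure) (\<lambda>x. (dir x, N x))) (\<lambda>(\<theta>, r). g \<theta> r)"
    by (subst nn_integral_distr) auto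
  also have "\<dots> = (\<integral>\<^sup>+\<theta>. (\<integral>\<^sup>+r. g \<theta> r \<partial>radius_measure) \<partial>cone_measure)"
    unfolding distr_weight_measure_polar using R.nn_integral_fst[OF g'] by simp
  finally show ?thesis unfolding radial .
qed

end

section \<open>The isoperimetric and concavity bounds\<close>

text \<open>Replacing \<open>K\<close> by \<open>Z\<close> gives up points where \<open>f\<close> is
  at least \<open>m\<close> in exchange for points, of no larger total measure, where
  \<open>f\<close> is at most \<open>m\<close>.\<close>

lemma nn_integral_bathtub:
  fixes f :: "'a \<Rightarrow> ennreal"
  assumes f [measurable]: "f \<in> borel_measurable M" and [measurable]: "K \<in> sets M" "Z \<in> sets M"
    and le: "emeasure M Z \<le> emeasure M K" and fin: "emeasure M Z < \<infinity>"
    and K: "\<And>x. x \<in> K - Z \<Longrightarrow> m \<le> f x" and Z: "\<And>x. x \<in> Z - K \<Longrightarrow> f x \<le> m"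
  shows "(\<integral>\<^sup>+x\<in>Z. f x \<partial>M) \<le> (\<integral>\<^sup>+x\<in>K. f x \<partial>M)"
proof -
  have split: "emeasure M X = emeasure M (X \<inter> Y) + emeasure M (X - Y)" if "X \<in> sets M" "Y \<in> sets M" for X Y
    using that by (subst plus_emeasure) (auto intro!: arg_cong2[where f=emeasure])
  have "emeasure M (Z \<inter> K) + emeasure M (Z - K) \<le> emeasure M (Z \<inter> K) + emeasure M (K - Z)"
    using le split[of Z K] split[of K Z] by (simp add: Int_commute)
  \<comment> \<open>Finiteness permits cancelling the common part.\<close>
  moreover have "emeasure M (Z \<inter> K) < \<infinity>"
    using fin by (rule le_less_trans[rotated]) (intro emeasure_mono, auto)
  ultimately have diff: "emeasure M (Z - K) \<le> emeasure M (K - Z)"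
    by (auto simp: ennreal_add_left_cancel_le)
  have split': "(\<integral>\<^sup>+x\<in>X. f x \<partial>M) = (\<integral>\<^sup>+x\<in>X \<inter> Y. f x \<partial>M) + (\<integral>\<^sup>+x\<in>X - Y. f x \<partial>M)"
    if [measurable]: "X \<in> sets M" "Y \<in> sets M" for X Y
    by (subst nn_integral_add[symmetric]) (auto intro!: nn_integral_cong simp: indicator_def)
  have "(\<integral>\<^sup>+x\<in>Z - K. f x \<partial>M) \<le> (\<integral>\<^sup>+x\<in>Z - K. m \<partial>M)"
    using Z by (intro nn_integral_mono) (auto simp: indicator_def)
  also have "\<dots> = m * emeasure M (Z - K)"
    by (rule nn_integral_cmult_indicator) measurable
  also have "\<dots> \<le> m * emeasure M (K - Z)"
    by (intro mult_left_mono diff) simp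
  also have "\<dots> = (\<integral>\<^sup>+x\<in>K - Z. m \<partial>M)"
    by (rule nn_integral_cmult_indicator[symmetric]) measurable
  also have "\<dots> \<le> (\<integral>\<^sup>+x\<in>K - Z. f x \<partial>M)"
    using K by (intro nn_integral_mono) (auto simp: indicator_def)
  finally have "(\<integral>\<^sup>+x\<in>Z \<inter> K. f x \<partial>M) + (\<integral>\<^sup>+x\<in>Z - K. f x \<partial>M) \<le> (\<integral>\<^sup>+x\<in>Z \<inter> K. f x \<partial>M) + (\<integral>\<^sup>+x\<in>K - Z. f x \<partial>M)"
    by (rule add_left_mono)
  then show ?thesis
    using split'[of Z K] split'[of K Z] by (simp add: Int_commute)
qed

locale radial_star_measure = weighted_star_domain B \<rho> w + log_convex_density \<phi>
  for B :: "(real ^ 'n) set" and \<rho> w :: "real ^ 'n \<Rightarrow> real" and \<phi> :: "real \<Rightarrow> real"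
begin

abbreviation \<mu> :: "(real ^ 'n) measure" where "\<mu> \<equiv> radial_measure \<rho> w \<phi>"
abbreviation c :: real where "c \<equiv> weight_const B w"
abbreviation \<psi> :: "real \<Rightarrow> real" where "\<psi> \<equiv> (\<lambda>s. c * \<phi> s)"

text \<open>Outside the positive reals \<open>\<phi>\<close> is arbitrary, possibly not even measurable.\<close>

definition extended_profile :: "real \<Rightarrow> real" where "extended_profile = (\<lambda>s. if s \<in> {0<..} then \<phi> s else 0)"

lemma extended_profile_measurable [measurable]: "extended_profile \<in> borel_measurable borel"
  unfolding extended_profile_def by (rule borel_measurable_profile)

lemma extended_profile_eq [simp]: "0 < s \<Longrightarrow> extended_profile s = \<phi> s"
  and extended_profile_nonpos [simp]: "s \<le> 0 \<Longrightarrow> extended_profile s = 0"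
  by (auto simp: extended_profile_def)

section \<open>The radial measure in polar coordinates\<close>

lemma sets_mu [measurable_cong, simp]: "sets \<mu> = sets lebesgue"
  and space_mu [simp]: "space \<mu> = UNIV"
  by (simp_all add: radial_measure_def)

lemma borel_in_sets_mu: "A \<in> sets borel \<Longrightarrow> A \<in> sets \<mu>"
  by simp

lemma radial_in_sets_mu [simp]:
  "{x. N x < z} \<in> sets lebesgue" "{x. z < N x} \<in> sets lebesgue" "{x. N x = z} \<in> sets lebesgue"
  "J \<in> sets borel \<Longrightarrow> {x. N x \<in> J} \<in> sets lebesgue"
  by (rule sets_completionI_sets, simp)+

lemma borel_measurable_mu: "f \<in> borel_measurable borel \<Longrightarrow> f \<in> borel_measurable \<mu>"
  by (auto simp: measurable_cong_sets[OF sets_mu refl] intro!: measurable_completion)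

text \<open>Homogeneity of \<open>w\<close> absorbs one power of \<open>N x\<close>. The remaining
  factor N^(-n) is the one that cancels r^n in polar coordinates and leaves \<phi>(r) dr on each
  ray.\<close>

lemma density_eq:
  assumes "x \<noteq> 0"
  shows "ennreal (w (x /\<^sub>R N x) * N x powi (1 - int CARD('n)) * \<phi> (N x)) =
    ennreal (w x) * ennreal (inverse (N x ^ CARD('n)) * extended_profile (N x))"
proof -
  have N: "0 < N x" "N x \<noteq> 0" using N_pos[OF assms] by auto
  have "w (x /\<^sub>R N x) = inverse (N x) * w x"
    using weight_homogeneous N by (simp add: one_homogeneous_def)
  moreover have "inverse (N x) * N x powi (1 - int CARD('n)) = inverse (N x ^ CARD('n))"
    using N by (subst power_int_diff) (auto simp: field_simps)
  ultimately have "w (x /\<^sub>R N x) * N x powi (1 - int CARD('n)) * \<phi> (N x) = w x * (inverse (N x ^ CARD('n)) * extended_profile (N x))"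
    using N by (simp add: mult_ac)
  then show ?thesis using weight_nonneg by (simp add: ennreal_mult')
qed

lemma mu_eq_density:
  "\<mu> = density lebesgue (\<lambda>x. ennreal (w x) * ennreal (inverse (N x ^ CARD('n)) * extended_profile (N x)))"
  (is "_ = density _ ?g")
proof -
  let ?f = "\<lambda>x. ennreal (w (x /\<^sub>R N x) * N x powi (1 - int CARD('n)) * \<phi> (N x))"
  have g: "?g \<in> borel_measurable lebesgue"
    by (rule borel_measurable_weight_times) measurable
  \<comment> \<open>The measurability of \<open>?f\<close> is not immediate, as \<phi> is arbitrary
    at 0; but \<open>?f\<close> differs from the measurable \<open>?g\<close> at the origin at
    most.\<close>
  have "?f = (\<lambda>x. if x = 0 then ?f 0 else ?g x)"
    using density_eq by (auto simp: fun_eq_iff)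
  also have "\<dots> \<in> borel_measurable lebesgue"
    by (rule measurable_If) (use g in auto)
  finally have f: "?f \<in> borel_measurable lebesgue" .
  have "AE x in lebesgue. x \<noteq> (0::real^'n)"
    by (rule AE_not_in[where N="{0}", simplified]) (auto simp: null_sets_completionI finite_imp_null_set_lborel)
  then have "AE x in lebesgue. ?f x = ?g x"
    by eventually_elim (rule density_eq)
  then show ?thesis
    unfolding radial_measure_def using density_cong[OF f g] by simp
qed

lemma nn_integral_mu:
  assumes f [measurable]: "f \<in> borel_measurable borel"
  shows "integral\<^sup>N \<mu> f = (\<integral>\<^sup>+\<theta>. (\<integral>\<^sup>+r. ennreal (extended_profile r) * f (r *\<^sub>R \<theta>) \<partial>lborel) \<partial>cone_measure)"
proof -
  let ?h = "\<lambda>r. ennreal (inverse (r ^ CARD('n)) * extended_profile r)"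
  have cancel: "ennreal (r ^ CARD('n)) * (?h r * f (r *\<^sub>R \<theta>)) * indicator {0<..} r = ennreal (extended_profile r) * f (r *\<^sub>R \<theta>)" for r \<theta>
  proof (cases "0 < r")
    case True
    have "ennreal (r ^ CARD('n)) * ?h r = ennreal (r ^ CARD('n) * (inverse (r ^ CARD('n)) * extended_profile r))"
      using True by (intro ennreal_mult'[symmetric]) simp
    also have "\<dots> = ennreal (extended_profile r)" using True by (simp add: mult.assoc[symmetric])
    finally show ?thesis using True by (simp add: mult.assoc[symmetric])
  qed simp
  have "integral\<^sup>N \<mu> f = (\<integral>\<^sup>+x. ennreal (w x) * ?h (N x) * f x \<partial>lebesgue)"
    unfolding mu_eq_density
    by (rule nn_integral_density, rule borel_measurable_weight_times, measurable)
      (intro measurable_completion, simp)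
  also have "\<dots> = (\<integral>\<^sup>+x. ennreal (w x) * (?h (N x) * f x) \<partial>lebesgue)"
    by (simp add: mult.assoc)
  also have "\<dots> = (\<integral>\<^sup>+x. ?h (N x) * f x \<partial>weight_measure)"
    by (rule nn_integral_weight_measure[symmetric]) measurable
  \<comment> \<open>Writing \<open>x\<close> as \<open>N x *\<^sub>R dir x\<close> exhibits the
    integrand as a function of direction and radius.\<close>
  also have "\<dots> = (\<integral>\<^sup>+x. ?h (N x) * f (N x *\<^sub>R dir x) \<partial>weight_measure)"
    by (simp add: N_scaleR_dir)
  also have "\<dots> = (\<integral>\<^sup>+\<theta>. (\<integral>\<^sup>+r\<in>{0<..}. ennreal (r ^ CARD('n)) * (?h r * f (r *\<^sub>R \<theta>)) \<partial>lborel) \<partial>cone_measure)"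
    by (rule nn_integral_polar[where g = "\<lambda>\<theta> r. ?h r * f (r *\<^sub>R \<theta>)"]) measurable
  finally show ?thesis unfolding cancel .
qed

lemma emeasure_mu:
  assumes "A \<in> sets borel"
  shows "emeasure \<mu> A = (\<integral>\<^sup>+\<theta>. (\<integral>\<^sup>+r. ennreal (extended_profile r) * indicator A (r *\<^sub>R \<theta>) \<partial>lborel) \<partial>cone_measure)"
  using nn_integral_mu[of "indicator A"] assms by simp

lemma AE_N_ray: "AE \<theta> in cone_measure. \<forall>r\<ge>0. N (r *\<^sub>R \<theta>) = r"
  using AE_cone_measure_N by eventually_elim (auto simp: N_scaleR)

lemma nn_integral_mu_radial:
  assumes g [measurable]: "g \<in> borel_measurable borel"
  shows "(\<integral>\<^sup>+x. g (N x) \<partial>\<mu>) = (\<integral>\<^sup>+r. ennreal (extended_profile r) * g r \<partial>lborel) * ennreal c"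
proof -
  have "(\<integral>\<^sup>+x. g (N x) \<partial>\<mu>) = (\<integral>\<^sup>+\<theta>. (\<integral>\<^sup>+r. ennreal (extended_profile r) * g (N (r *\<^sub>R \<theta>)) \<partial>lborel) \<partial>cone_measure)"
    by (rule nn_integral_mu) measurable
  also have "\<dots> = (\<integral>\<^sup>+\<theta>. (\<integral>\<^sup>+r. ennreal (extended_profile r) * g r \<partial>lborel) \<partial>cone_measure)"
  proof (rule nn_integral_cong_AE)
    show "AE \<theta> in cone_measure. (\<integral>\<^sup>+r. ennreal (extended_profile r) * g (N (r *\<^sub>R \<theta>)) \<partial>lborel) = (\<integral>\<^sup>+r. ennreal (extended_profile r) * g r \<partial>lborel)"
      using AE_N_ray
    proof eventually_elim
      case (elim \<theta>)
      have "ennreal (extended_profile r) * g (N (r *\<^sub>R \<theta>)) = ennreal (extended_profile r) * g r" for r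
        using elim by (cases "0 < r") auto
      then show ?case by simp
    qed
  qed
  also have "\<dots> = (\<integral>\<^sup>+r. ennreal (extended_profile r) * g r \<partial>lborel) * ennreal c"
    by (simp add: emeasure_cone_measure_UNIV[simplified])
  finally show ?thesis .
qed

section \<open>Shifting along rays towards the origin\<close>

lemma minkowski_add_ray:
  assumes "N \<theta> = 1" and x: "r *\<^sub>R \<theta> \<notin> minkowski_add A t B" and "0 \<le> \<tau>" "\<tau> < t"
  shows "(r - \<tau>) *\<^sub>R \<theta> \<notin> A"
proof
  assume "(r - \<tau>) *\<^sub>R \<theta> \<in> A"
  \<comment> \<open>The strict inequality \<open>\<tau> < t\<close> matters here: the gauge of this
    point is \<open>\<tau> / t\<close>, and \<open>B\<close> contains only points of gauge below
    1.\<close>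
  moreover have "(\<tau> / t) *\<^sub>R \<theta> \<in> B"
    using assms by (simp add: mem_domain_iff N_scaleR)
  moreover have "r *\<^sub>R \<theta> = (r - \<tau>) *\<^sub>R \<theta> + t *\<^sub>R ((\<tau> / t) *\<^sub>R \<theta>)"
    using assms by (simp add: scaleR_left_diff_distrib)
  ultimately have "r *\<^sub>R \<theta> \<in> minkowski_add A t B"
    unfolding minkowski_add_def by blast
  with x show False by blast
qed

text \<open>One point of \<open>K\<close> at radius \<open>r \<le> t\<close> puts the whole open
  segment from the origin to it into \<open>- A\<close>, and the integral of \<phi> along that ray
  is infinite. A complement of finite measure tolerates this only for a null set of
  directions.\<close>

lemma AE_ray_avoids:
  assumes [measurable]: "A \<in> sets borel" and fin: "emeasure \<mu> (- A) < \<infinity>"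
    and K: "K \<subseteq> - minkowski_add A t B"
  shows "AE \<theta> in cone_measure. \<forall>r. 0 < r \<longrightarrow> r \<le> t \<longrightarrow> r *\<^sub>R \<theta> \<notin> K"
proof -
  have "AE \<theta> in cone_measure. (\<integral>\<^sup>+r. ennreal (extended_profile r) * indicator (- A) (r *\<^sub>R \<theta>) \<partial>lborel) \<noteq> \<infinity>"
    using fin by (intro nn_integral_PInf_AE) (auto simp: emeasure_mu)
  then show ?thesis
    using AE_cone_measure_N
  proof eventually_elim
    case (elim \<theta>)
    show ?case
    proof (intro allI impI notI)
      fix r assume r: "0 < r" "r \<le> t" "r *\<^sub>R \<theta> \<in> K"
      \<comment> \<open>The shift is \<open>r - s\<close>, which is below \<open>t\<close> because
        \<open>s > 0\<close>, even when \<open>r = t\<close>.\<close>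
      have "s *\<^sub>R \<theta> \<notin> A" if "0 < s" "s < r" for s
        using minkowski_add_ray[of \<theta> r A t "r - s"] elim K r that by auto
      then have "(\<integral>\<^sup>+s\<in>{0<..<r}. \<phi> s \<partial>lborel) \<le> (\<integral>\<^sup>+r. ennreal (extended_profile r) * indicator (- A) (r *\<^sub>R \<theta>) \<partial>lborel)"
        by (intro nn_integral_mono) (auto simp: indicator_def)
      with nonint[OF r(1)] elim show False by (simp add: top_unique)
    qed
  qed
qed

text \<open>The quotient turns \<phi>(r) dr into \<phi>(r - \<tau>) dr, so that after a translation
  by \<tau> the left side is an integral of \<phi> over ray segments contained in
  \<open>- A\<close>. The condition \<open>t < N x\<close> keeps the shifted radius
  positive.\<close>

lemma shift_estimate:
  assumes [measurable]: "A \<in> sets borel" "K \<in> sets borel"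
    and K: "K \<subseteq> - minkowski_add A t B" and \<tau>: "0 < \<tau>" "\<tau> < t"
  shows "(\<integral>\<^sup>+x\<in>K \<inter> {x. t < N x}. ennreal (extended_profile (N x - \<tau>) / extended_profile (N x)) \<partial>\<mu>) \<le> emeasure \<mu> (- A)"
proof -
  have "(\<integral>\<^sup>+x\<in>K \<inter> {x. t < N x}. ennreal (extended_profile (N x - \<tau>) / extended_profile (N x)) \<partial>\<mu>) =
      (\<integral>\<^sup>+\<theta>. (\<integral>\<^sup>+r. ennreal (extended_profile r) * (ennreal (extended_profile (N (r *\<^sub>R \<theta>) - \<tau>) / extended_profile (N (r *\<^sub>R \<theta>))) *
        indicator (K \<inter> {x. t < N x}) (r *\<^sub>R \<theta>)) \<partial>lborel) \<partial>cone_measure)"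
    by (rule nn_integral_mu) measurable
  also have "\<dots> \<le> (\<integral>\<^sup>+\<theta>. (\<integral>\<^sup>+r. ennreal (extended_profile r) * indicator (- A) (r *\<^sub>R \<theta>) \<partial>lborel) \<partial>cone_measure)"
  proof (rule nn_integral_mono_AE)
    show "AE \<theta> in cone_measure.
        (\<integral>\<^sup>+r. ennreal (extended_profile r) * (ennreal (extended_profile (N (r *\<^sub>R \<theta>) - \<tau>) / extended_profile (N (r *\<^sub>R \<theta>))) *
          indicator (K \<inter> {x. t < N x}) (r *\<^sub>R \<theta>)) \<partial>lborel)
        \<le> (\<integral>\<^sup>+r. ennreal (extended_profile r) * indicator (- A) (r *\<^sub>R \<theta>) \<partial>lborel)"
      using AE_N_ray AE_cone_measure_N
    proof eventually_elim
      case (elim \<theta>)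
      \<comment> \<open>The form \<open>- \<tau> + 1 * r\<close> prepares the affine substitution
        that follows.\<close>
      have "ennreal (extended_profile r) * (ennreal (extended_profile (N (r *\<^sub>R \<theta>) - \<tau>) / extended_profile (N (r *\<^sub>R \<theta>))) *
          indicator (K \<inter> {x. t < N x}) (r *\<^sub>R \<theta>)) \<le> ennreal (extended_profile (- \<tau> + 1 * r)) * indicator (- A) ((- \<tau> + 1 * r) *\<^sub>R \<theta>)" for r
      proof (cases "0 < r \<and> r *\<^sub>R \<theta> \<in> K \<and> t < r")
        case True
        then have N: "N (r *\<^sub>R \<theta>) = r" and "0 < \<phi> r" using elim pos by auto
        moreover have "(r - \<tau>) *\<^sub>R \<theta> \<notin> A"
          using minkowski_add_ray[of \<theta> r A t \<tau>] elim True K \<tau> by auto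
        moreover have "ennreal (\<phi> r) * ennreal (extended_profile (r - \<tau>) / \<phi> r) = ennreal (extended_profile (r - \<tau>))"
          using \<open>0 < \<phi> r\<close> by (simp add: ennreal_mult'[symmetric])
        ultimately show ?thesis using True by (simp add: indicator_def)
      next
        case False
        then show ?thesis using elim by (cases "0 < r") (auto simp: indicator_def)
      qed
      then have "(\<integral>\<^sup>+r. ennreal (extended_profile r) * (ennreal (extended_profile (N (r *\<^sub>R \<theta>) - \<tau>) / extended_profile (N (r *\<^sub>R \<theta>))) *
          indicator (K \<inter> {x. t < N x}) (r *\<^sub>R \<theta>)) \<partial>lborel) \<le>
          (\<integral>\<^sup>+r. ennreal (extended_profile (- \<tau> + 1 * r)) * indicator (- A) ((- \<tau> + 1 * r) *\<^sub>R \<theta>) \<partial>lborel)"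
        by (rule nn_integral_mono)
      also have "\<dots> = (\<integral>\<^sup>+r. ennreal (extended_profile r) * indicator (- A) (r *\<^sub>R \<theta>) \<partial>lborel)"
        using nn_integral_real_affine[of "\<lambda>r. ennreal (extended_profile r) * indicator (- A) (r *\<^sub>R \<theta>)" 1 "- \<tau>"]
        by simp
      finally show ?case .
    qed
  qed
  also have "\<dots> = emeasure \<mu> (- A)"
    by (simp add: emeasure_mu)
  finally show ?thesis .
qed

lemma emeasure_mu_degenerate:
  assumes "c = 0"
  shows "emeasure \<mu> A = 0"
proof -
  have "cone_measure = null_measure borel"
    using emeasure_cone_measure_UNIV assms
    by (intro measure_eqI) (auto intro: emeasure_eq_0[of UNIV])
  then have "emeasure \<mu> UNIV = 0"
    using emeasure_mu[of UNIV] by (simp add: nn_integral_null_measure)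
  then show ?thesis by (rule emeasure_eq_0[rotated]) auto
qed

lemma weight_const_nonneg: "0 \<le> c"
  unfolding weight_const_def set_lebesgue_integral_def
  using weight_nonneg by (intro mult_nonneg_nonneg integral_nonneg_AE) auto

end

text \<open>With c > 0 the scaled density \<psi> is again positive and log-convex, so that
  everything about tails holds for it.\<close>

locale nondegenerate_radial_star_measure = radial_star_measure +
  assumes weight_const_pos: "0 < c"
begin

interpretation scaled: log_convex_density \<psi>
  by (rule log_convex_density_cmult[OF weight_const_pos])

lemma scaled_eq: "ennreal (\<psi> r) = ennreal (\<phi> r) * ennreal c"
  using weight_const_pos by (simp add: mult.commute[of c] ennreal_mult'')

text \<open>Every ray carries \<phi>(r) dr and the directions have total mass c, so the radii are
  distributed with density \<psi>.\<close>

lemma emeasure_mu_radial: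
  assumes J [measurable]: "J \<in> sets borel" and "J \<subseteq> {0<..}"
  shows "emeasure \<mu> {x. N x \<in> J} = emeasure scaled.profile_measure J"
proof -
  have "emeasure \<mu> {x. N x \<in> J} = (\<integral>\<^sup>+x. indicator {x. N x \<in> J} x \<partial>\<mu>)"
    by (rule nn_integral_indicator[symmetric]) (rule borel_in_sets_mu, measurable)
  also have "\<dots> = (\<integral>\<^sup>+x. indicator J (N x) \<partial>\<mu>)"
    by (intro nn_integral_cong) (auto simp: indicator_def)
  also have "\<dots> = (\<integral>\<^sup>+r. ennreal (extended_profile r) * indicator J r \<partial>lborel) * ennreal c"
    by (rule nn_integral_mu_radial) measurable
  also have "\<dots> = (\<integral>\<^sup>+r. ennreal (extended_profile r) * indicator J r * ennreal c \<partial>lborel)"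
    by (rule nn_integral_multc[symmetric]) measurable
  also have "\<dots> = (\<integral>\<^sup>+r\<in>J. \<psi> r \<partial>lborel)"
    using assms(2) by (intro nn_integral_cong) (auto simp: indicator_def scaled_eq)
  also have "\<dots> = emeasure scaled.profile_measure J"
    using assms by (rule scaled.emeasure_profile_measure[symmetric])
  finally show ?thesis .
qed

lemma emeasure_mu_outside: "0 < z \<Longrightarrow> emeasure \<mu> {x. z < N x} = tail \<psi> (ennreal z)"
  using emeasure_mu_radial[of "{z<..}"] by (simp add: scaled.tail_ennreal)

lemma AE_mu_N_neq: "AE x in \<mu>. N x \<noteq> z"
proof (rule AE_I)
  have "emeasure \<mu> {x. N x = z} = (\<integral>\<^sup>+x. indicator {x. N x = z} x \<partial>\<mu>)"
    by (rule nn_integral_indicator[symmetric]) (rule borel_in_sets_mu, measurable)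
  also have "\<dots> = (\<integral>\<^sup>+x. indicator {z} (N x) \<partial>\<mu>)"
    by (intro nn_integral_cong) (auto simp: indicator_def)
  also have "\<dots> = (\<integral>\<^sup>+r. ennreal (extended_profile r) * indicator {z} r \<partial>lborel) * ennreal c"
    by (rule nn_integral_mu_radial) measurable
  also have "\<dots> = 0" by (simp add: nn_integral_null_set finite_imp_null_set_lborel)
  finally show "emeasure \<mu> {x. N x = z} = 0" .
  show "{x. N x = z} \<in> sets \<mu>" by (rule borel_in_sets_mu) measurable
qed simp

lemma emeasure_mu_complement: "0 < z \<Longrightarrow> emeasure \<mu> (- {x. N x < z}) = tail \<psi> (ennreal z)"
proof -
  assume z: "0 < z"
  have "emeasure \<mu> (- {x. N x < z}) = emeasure \<mu> {x. z < N x}"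
  proof (rule emeasure_eq_AE)
    show "AE x in \<mu>. x \<in> - {x. N x < z} \<longleftrightarrow> x \<in> {x. z < N x}"
      using AE_mu_N_neq[of z] by eventually_elim auto
  qed (auto intro: borel_in_sets_mu)
  then show ?thesis using emeasure_mu_outside[OF z] by simp
qed

lemma complement_estimate_tau:
  assumes A [measurable]: "A \<in> sets borel" "K \<in> sets borel"
    and K: "K \<subseteq> - minkowski_add A t B" and \<tau>: "0 < \<tau>" "\<tau> < t" and z: "t \<le> z"
    and eq: "emeasure \<mu> (K \<inter> {x. t < N x}) = tail \<psi> (ennreal z)"
  shows "tail \<psi> (ennreal (z - \<tau>)) \<le> emeasure \<mu> (- A)"
proof -
  let ?R = "\<lambda>r. ennreal (extended_profile (r - \<tau>) / extended_profile r)"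
  \<comment> \<open>The \<open>ratio\<close> axiom at base points \<open>r - \<tau>\<close> and
    \<open>s - \<tau>\<close> with increment \<tau>.\<close>
  have R: "?R s \<le> ?R r" if "\<tau> < r" "r \<le> s" for r s
  proof -
    have "\<phi> (s - \<tau>) * \<phi> r \<le> \<phi> (r - \<tau>) * \<phi> s"
      using ratio[of "r - \<tau>" "s - \<tau>" \<tau>] that \<tau> by (simp add: mult.commute)
    moreover have "0 < \<phi> r" "0 < \<phi> s" using that \<tau> by (auto intro: pos)
    ultimately show ?thesis using that \<tau> by (intro ennreal_leI) (simp add: field_simps)
  qed
  have "tail \<psi> (ennreal (z - \<tau>)) = (\<integral>\<^sup>+r\<in>{z - \<tau><..}. ennreal (\<psi> r) \<partial>lborel)"
    using z \<tau> by (simp add: scaled.tail_ennreal scaled.emeasure_profile_measure)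
  also have "\<dots> = (\<integral>\<^sup>+r. (ennreal (extended_profile r) * indicator {z - \<tau><..} r) * ennreal c \<partial>lborel)"
    using z \<tau> by (intro nn_integral_cong) (auto simp: indicator_def scaled_eq)
  also have "\<dots> = (\<integral>\<^sup>+r. ennreal (extended_profile r) * indicator {z - \<tau><..} r \<partial>lborel) * ennreal c"
    by (rule nn_integral_multc) measurable
  also have "(\<integral>\<^sup>+r. ennreal (extended_profile r) * indicator {z - \<tau><..} r \<partial>lborel) =
      (\<integral>\<^sup>+r. ennreal (extended_profile (- \<tau> + 1 * r)) * indicator {z - \<tau><..} (- \<tau> + 1 * r) \<partial>lborel)"
    using nn_integral_real_affine[of "\<lambda>r. ennreal (extended_profile r) * indicator {z - \<tau><..} r" 1 "- \<tau>"] by simp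
  also have "\<dots> = (\<integral>\<^sup>+r. ennreal (extended_profile r) * (?R r * indicator {z<..} r) \<partial>lborel)"
  proof (intro nn_integral_cong)
    fix r
    show "ennreal (extended_profile (- \<tau> + 1 * r)) * indicator {z - \<tau><..} (- \<tau> + 1 * r) =
        ennreal (extended_profile r) * (?R r * indicator {z<..} r)"
    proof (cases "z < r")
      case True
      then have "0 < \<phi> r" "0 < r" using z \<tau> by (auto intro: pos)
      then have "ennreal (\<phi> r) * ennreal (extended_profile (r - \<tau>) / \<phi> r) = ennreal (extended_profile (r - \<tau>))"
        by (simp add: ennreal_mult'[symmetric])
      then show ?thesis using True \<open>0 < r\<close> by simp
    qed simp
  qed
  also have "\<dots> * ennreal c = (\<integral>\<^sup>+x. ?R (N x) * indicator {z<..} (N x) \<partial>\<mu>)"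
    by (rule nn_integral_mu_radial[symmetric]) measurable
  also have "\<dots> = (\<integral>\<^sup>+x\<in>{x. z < N x}. ?R (N x) \<partial>\<mu>)"
    by (intro nn_integral_cong) (auto simp: indicator_def)
  \<comment> \<open>The threshold is the value of the quotient at radius \<open>z\<close>: the part
    of \<open>K\<close> outside the exterior region has radius at most \<open>z\<close>, where the
    quotient is at least that value.\<close>
  also have "\<dots> \<le> (\<integral>\<^sup>+x\<in>K \<inter> {x. t < N x}. ?R (N x) \<partial>\<mu>)"
  proof (rule nn_integral_bathtub)
    show "(\<lambda>x. ?R (N x)) \<in> borel_measurable \<mu>"
      by (rule borel_measurable_mu) measurable
    show "K \<inter> {x. t < N x} \<in> sets \<mu>" "{x. z < N x} \<in> sets \<mu>"
      using A(2) by auto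
    show "emeasure \<mu> {x. z < N x} \<le> emeasure \<mu> (K \<inter> {x. t < N x})" "emeasure \<mu> {x. z < N x} < \<infinity>"
      using eq emeasure_mu_outside[of z] scaled.tail_finite[of z] z \<tau> by auto
    show "?R z \<le> ?R (N x)" if "x \<in> K \<inter> {x. t < N x} - {x. z < N x}" for x
      using that \<tau> by (intro R) auto
    show "?R (N x) \<le> ?R z" if "x \<in> {x. z < N x} - K \<inter> {x. t < N x}" for x
      using that \<tau> z by (intro R) auto
  qed
  also have "\<dots> \<le> emeasure \<mu> (- A)"
    by (rule shift_estimate[OF A K \<tau>])
  finally show ?thesis .
qed

lemma minkowski_add_zero: "minkowski_add A 0 B = A"
proof -
  have "0 \<in> B" by (simp add: mem_domain_iff)
  then show ?thesis unfolding minkowski_add_def by auto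
qed

lemma complement_estimate_borel:
  assumes A [measurable]: "A \<in> sets borel" "K \<in> sets borel" and fin: "emeasure \<mu> (- A) < \<infinity>"
    and K: "K \<subseteq> - minkowski_add A t B" and t: "0 \<le> t"
  shows "emeasure \<mu> K \<le> tail \<psi> (tail_inv \<psi> (emeasure \<mu> (- A)) + ennreal t)"
\<comment> \<open>For \<open>t = 0\<close> there is no shift strictly between 0 and
  \<open>t\<close>, but then \<open>K\<close> lies in \<open>- A\<close>. A null set
  \<open>K\<close> corresponds to no finite radius \<open>z\<close>.\<close>
proof (cases "t = 0 \<or> emeasure \<mu> K = 0")
  case True
  then show ?thesis
    using K fin by (auto simp: minkowski_add_zero scaled.tail_tail_inv intro!: emeasure_mono)
next
  case False
  with t have t: "0 < t" and K0: "emeasure \<mu> K \<noteq> 0" by auto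
  have "(\<integral>\<^sup>+\<theta>. (\<integral>\<^sup>+r. ennreal (extended_profile r) * indicator K (r *\<^sub>R \<theta>) \<partial>lborel) \<partial>cone_measure) =
      (\<integral>\<^sup>+\<theta>. (\<integral>\<^sup>+r. ennreal (extended_profile r) * indicator (K \<inter> {x. t < N x}) (r *\<^sub>R \<theta>) \<partial>lborel) \<partial>cone_measure)"
  proof (rule nn_integral_cong_AE)
    show "AE \<theta> in cone_measure. (\<integral>\<^sup>+r. ennreal (extended_profile r) * indicator K (r *\<^sub>R \<theta>) \<partial>lborel) =
        (\<integral>\<^sup>+r. ennreal (extended_profile r) * indicator (K \<inter> {x. t < N x}) (r *\<^sub>R \<theta>) \<partial>lborel)"
      using AE_N_ray AE_ray_avoids[OF A(1) fin K]
    proof eventually_elim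
      case (elim \<theta>)
      have "ennreal (extended_profile r) * indicator K (r *\<^sub>R \<theta>) = ennreal (extended_profile r) * indicator (K \<inter> {x. t < N x}) (r *\<^sub>R \<theta>)" for r
        using elim by (cases "0 < r") (auto simp: indicator_def not_less)
      then show ?case by simp
    qed
  qed
  then have eq: "emeasure \<mu> K = emeasure \<mu> (K \<inter> {x. t < N x})"
    by (simp add: emeasure_mu)
  also have "\<dots> \<le> emeasure \<mu> {x. t < N x}"
    by (intro emeasure_mono) auto
  also have "\<dots> = tail \<psi> (ennreal t)" by (rule emeasure_mu_outside[OF t])
  finally have le: "emeasure \<mu> K \<le> tail \<psi> (ennreal t)" .
  then have "emeasure \<mu> K < \<infinity>" using scaled.tail_finite[OF t] by (rule le_less_trans)
  then obtain z where z: "0 < z" "tail \<psi> (ennreal z) = emeasure \<mu> K"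
    using scaled.tail_surj[of "emeasure \<mu> K"] K0 by (auto simp: zero_less_iff_neq_zero)
  have tz: "t \<le> z" using le z t scaled.tail_le_iff[of z t] by simp
  have est: "tail \<psi> (ennreal (z - \<tau>)) \<le> emeasure \<mu> (- A)" if "0 < \<tau>" "\<tau> < t" for \<tau>
    using complement_estimate_tau[OF A K that tz] eq z by simp
  \<comment> \<open>A positive lower bound, obtained from the shift \<open>t/2\<close>, guarantees a
    finite radius \<open>y\<close> for the complement of \<open>A\<close>.\<close>
  have "emeasure \<mu> (- A) \<noteq> 0"
    using est[of "t/2"] scaled.tail_pos[of "z - t/2"] t tz by auto
  then obtain y where y: "0 < y" "tail \<psi> (ennreal y) = emeasure \<mu> (- A)"
    using scaled.tail_surj[of "emeasure \<mu> (- A)"] fin by (auto simp: zero_less_iff_neq_zero)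
  have "y \<le> z - \<tau>" if "0 < \<tau>" "\<tau> < t" for \<tau>
    using est[OF that] y tz that scaled.tail_le_iff[of "z - \<tau>" y] by simp
  then have "\<tau> \<le> z - y" if "0 < \<tau>" "\<tau> < t" for \<tau>
    using that by (simp add: algebra_simps)
  \<comment> \<open>The limit of \<tau> to \<open>t\<close> is taken on the level of radii, where it
    is just density of the order.\<close>
  then have "t \<le> z - y" using t by (intro dense_le_bounded[of 0 t]) auto
  then have "tail \<psi> (ennreal z) \<le> tail \<psi> (ennreal (y + t))"
    using z y t by (subst scaled.tail_le_iff) auto
  moreover have "tail_inv \<psi> (emeasure \<mu> (- A)) + ennreal t = ennreal (y + t)"
    using y t scaled.tail_inv_tail[OF y(1)] by simp
  ultimately show ?thesis using z by simp
qed

text \<open>A Lebesgue measurable set is a Borel subset of it plus part of a Lebesgue null set,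
  which is also null for \<mu> by absolute continuity. This generality is needed because inner
  measures and measurable covers range over Lebesgue sets.\<close>

lemma complement_estimate:
  assumes A: "A \<in> sets borel" and K: "K \<in> sets \<mu>" and fin: "emeasure \<mu> (- A) < \<infinity>"
    and sub: "K \<subseteq> - minkowski_add A t B" and t: "0 \<le> t"
  shows "emeasure \<mu> K \<le> tail \<psi> (tail_inv \<psi> (emeasure \<mu> (- A)) + ennreal t)"
proof -
  obtain S N' N'' where S: "S \<in> sets lborel" "K = S \<union> N'" "N' \<subseteq> N''" "N'' \<in> null_sets lborel"
    using K by (auto elim: sets_completionE)
  have "absolutely_continuous lebesgue \<mu>"
    unfolding mu_eq_density
    by (rule absolutely_continuousI_density, rule borel_measurable_weight_times) measurable
  then have "N'' \<in> null_sets \<mu>"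
    using S by (auto simp: absolutely_continuous_def null_sets_completionI)
  then have "emeasure \<mu> (S \<union> N'') = emeasure \<mu> S"
    using S by (intro emeasure_Un_null_set) auto
  moreover have "emeasure \<mu> K \<le> emeasure \<mu> (S \<union> N'')"
    using S by (intro emeasure_mono) auto
  moreover have "emeasure \<mu> S \<le> tail \<psi> (tail_inv \<psi> (emeasure \<mu> (- A)) + ennreal t)"
    using S sub by (intro complement_estimate_borel A fin t) auto
  ultimately show ?thesis by simp
qed

lemma one_sided_complemented_concave_mu:
  "one_sided_complemented_concave \<mu> B (tail \<psi>) (tail_inv \<psi>)"
proof -
  have "B = {x. N x < 1}" using mem_domain_iff by auto
  \<comment> \<open>The radius attached to \<open>- B\<close> is 1, so the multiple of it in the
    concavity inequality is \<open>t\<close> itself.\<close>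
  then have "tail_inv \<psi> (emeasure \<mu> (- B)) = 1"
    using emeasure_mu_complement[of 1] scaled.tail_inv_tail[of 1] by simp
  then show ?thesis
    unfolding one_sided_complemented_concave_def inner_measure_of_def
    by (auto intro!: SUP_least complement_estimate)
qed

section \<open>The isoperimetric inequality\<close>

lemma outer_boundary_ge:
  assumes C: "C \<in> sets borel" and y: "0 < y" "emeasure \<mu> C = tail \<psi> (ennreal y)" and e: "0 < \<epsilon>"
  shows "ennreal (\<epsilon> * \<psi> (y + \<epsilon>)) \<le> outer_measure_of \<mu> (minkowski_add (- C) \<epsilon> B - (- C))"
  unfolding outer_measure_of_def
proof (rule INF_greatest)
  fix X assume "X \<in> {X \<in> sets \<mu>. minkowski_add (- C) \<epsilon> B - - C \<subseteq> X}"
  then have X: "X \<in> sets \<mu>" "minkowski_add (- C) \<epsilon> B - - C \<subseteq> X" by auto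
  have C': "C \<in> sets \<mu>" using C by (rule borel_in_sets_mu)
  have fin: "emeasure \<mu> C < \<infinity>" using scaled.tail_finite y by simp
  \<comment> \<open>What a measurable cover \<open>X\<close> of the layer leaves of \<open>C\<close>
    avoids the enlarged complement, so the complement estimate with \<open>A = - C\<close> applies
    to it. The mass missing from \<open>C\<close> must then sit in \<open>X\<close>.\<close>
  have "emeasure \<mu> (C - X) \<le> tail \<psi> (tail_inv \<psi> (emeasure \<mu> (- (- C))) + ennreal \<epsilon>)"
    using X C' C fin e by (intro complement_estimate) (auto simp: sets.Diff)
  also have "tail_inv \<psi> (emeasure \<mu> (- (- C))) + ennreal \<epsilon> = ennreal (y + \<epsilon>)"
    using y e scaled.tail_inv_tail by simp
  finally have diff: "emeasure \<mu> (C - X) \<le> tail \<psi> (ennreal (y + \<epsilon>))" .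
  have "ennreal (\<epsilon> * \<psi> (y + \<epsilon>)) + tail \<psi> (ennreal (y + \<epsilon>)) \<le> emeasure \<mu> C"
    using scaled.tail_split[of y "y + \<epsilon>"] scaled.emeasure_Ioc_ge[of y "y + \<epsilon>"] y e
    by (simp add: add_right_mono)
  also have "\<dots> \<le> emeasure \<mu> (X \<union> (C - X))"
    using X C' by (intro emeasure_mono) auto
  also have "\<dots> \<le> emeasure \<mu> X + emeasure \<mu> (C - X)"
    using X C' by (intro emeasure_subadditive) auto
  also have "\<dots> \<le> emeasure \<mu> X + tail \<psi> (ennreal (y + \<epsilon>))"
    by (intro add_left_mono diff)
  finally show "ennreal (\<epsilon> * \<psi> (y + \<epsilon>)) \<le> emeasure \<mu> X"
    using scaled.tail_finite[of "y + \<epsilon>"] y e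
    by (auto simp: add.commute[of _ "tail _ _"] ennreal_add_left_cancel_le)
qed

lemma inner_boundary_measure_ge:
  assumes C: "C \<in> sets borel" and fin: "emeasure \<mu> C < \<infinity>"
  shows "tail_profile \<psi> (emeasure \<mu> C) \<le> inner_boundary_measure \<mu> B C"
proof (cases "emeasure \<mu> C = 0")
  case True
  \<comment> \<open>The profile is evaluated at \<infinity>, where it vanishes by
    convention.\<close>
  then show ?thesis by (simp add: tail_profile_def scaled.tail_inv_zero ext_at_infinity_def)
next
  case False
  then obtain y where y: "0 < y" "tail \<psi> (ennreal y) = emeasure \<mu> C"
    using scaled.tail_surj[of "emeasure \<mu> C"] fin by (auto simp: zero_less_iff_neq_zero)
  \<comment> \<open>The layer estimate involves \<open>\<psi> (y + \<epsilon>)\<close>; continuity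
    at \<open>y\<close> recovers the sharp value in the limit.\<close>
  have "isCont \<psi> y"
    using scaled.cont y by (simp add: continuous_on_eq_continuous_at)
  then have "((\<lambda>\<epsilon>. \<psi> (y + \<epsilon>)) \<longlongrightarrow> \<psi> y) (at 0)"
    unfolding isCont_def by (rule LIM_offset_zero)
  then have "((\<lambda>\<epsilon>. ennreal (\<psi> (y + \<epsilon>))) \<longlongrightarrow> ennreal (\<psi> y)) (at_right 0)"
    by (intro tendsto_ennrealI) (rule filterlim_mono[OF _ order_refl at_le], auto)
  then have "ennreal (\<psi> y) = Liminf (at_right 0) (\<lambda>\<epsilon>. ennreal (\<psi> (y + \<epsilon>)))"
    by (intro lim_imp_Liminf[symmetric]) auto
  also have "\<dots> \<le> inner_boundary_measure \<mu> B C"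
    unfolding inner_boundary_measure_def
  proof (rule Liminf_mono)
    show "\<forall>\<^sub>F \<epsilon> in at_right 0. ennreal (\<psi> (y + \<epsilon>)) \<le> outer_measure_of \<mu> (minkowski_add (- C) \<epsilon> B - - C) / ennreal \<epsilon>"
      using eventually_at_right_less[of 0]
    proof eventually_elim
      case (elim \<epsilon>)
      have "ennreal (\<psi> (y + \<epsilon>)) = ennreal (\<epsilon> * \<psi> (y + \<epsilon>)) / ennreal \<epsilon>"
        using elim scaled.pos[of "y + \<epsilon>"] y by (subst divide_ennreal) auto
      also have "\<dots> \<le> outer_measure_of \<mu> (minkowski_add (- C) \<epsilon> B - - C) / ennreal \<epsilon>"
        by (intro divide_right_mono_ennreal outer_boundary_ge C y(1) y(2)[symmetric] elim)
      finally show ?case .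
    qed
  qed
  also have "ennreal (\<psi> y) = tail_profile \<psi> (emeasure \<mu> C)"
    using y scaled.tail_inv_tail[OF y(1)] by (simp add: tail_profile_def ext_at_infinity_def)
  finally show ?thesis .
qed

section \<open>Sharpness for dilates of a convex domain\<close>

lemma minkowski_add_convex_subset:
  assumes "convex B" "0 < t" "0 < \<epsilon>"
  shows "minkowski_add {x. N x < t} \<epsilon> B \<subseteq> {x. N x < t + \<epsilon>}"
proof (clarsimp simp: minkowski_add_def)
  fix a b assume a: "N a < t" and b: "b \<in> B"
  \<comment> \<open>Rescaled by \<open>t + \<epsilon>\<close>, the sum is the convex combination of
    \<open>a /\<^sub>R t\<close> and \<open>b\<close> with weights proportional to \<open>t\<close>
    and \<epsilon>.\<close>
  have "a /\<^sub>R t \<in> B" using a assms by (simp add: mem_domain_iff N_scaleR field_simps)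
  moreover have "t / (t + \<epsilon>) + \<epsilon> / (t + \<epsilon>) = 1"
    using assms by (simp add: add_divide_distrib[symmetric])
  ultimately have "(t / (t + \<epsilon>)) *\<^sub>R (a /\<^sub>R t) + (\<epsilon> / (t + \<epsilon>)) *\<^sub>R b \<in> B"
    using assms b by (intro convexD) auto
  also have "(t / (t + \<epsilon>)) *\<^sub>R (a /\<^sub>R t) + (\<epsilon> / (t + \<epsilon>)) *\<^sub>R b = inverse (t + \<epsilon>) *\<^sub>R (a + \<epsilon> *\<^sub>R b)"
    using assms by (simp add: scaleR_right_distrib divide_inverse mult.commute)
  finally have "inverse (t + \<epsilon>) * N (a + \<epsilon> *\<^sub>R b) < 1"
    using assms by (simp add: mem_domain_iff N_scaleR)
  then show "N (a + \<epsilon> *\<^sub>R b) < t + \<epsilon>"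
    using assms by (simp add: field_simps)
qed

lemma inner_boundary_measure_homothetic_le:
  assumes cvx: "convex B" and t: "0 < t"
  shows "inner_boundary_measure \<mu> B (- {x. N x < t}) \<le> ennreal (\<psi> t)"
proof -
  have "inner_boundary_measure \<mu> B (- {x. N x < t}) \<le> Liminf (at_right (0::real)) (\<lambda>_. ennreal (\<psi> t))"
    unfolding inner_boundary_measure_def
  proof (rule Liminf_mono)
    show "\<forall>\<^sub>F \<epsilon> in at_right 0. outer_measure_of \<mu> (minkowski_add (- (- {x. N x < t})) \<epsilon> B - - (- {x. N x < t})) / ennreal \<epsilon> \<le> ennreal (\<psi> t)"
      using eventually_at_right_less[of 0]
    proof eventually_elim
      case (elim \<epsilon>)
      \<comment> \<open>The layer can meet the sphere \<open>N x = t\<close>; that sphere is null,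
        and the rest is a shell on which the density is at most \<open>\<psi> t\<close>.\<close>
      have "outer_measure_of \<mu> (minkowski_add {x. N x < t} \<epsilon> B - {x. N x < t}) \<le> outer_measure_of \<mu> ({x. N x \<in> {t<..t+\<epsilon>}} \<union> {x. N x = t})"
        using minkowski_add_convex_subset[OF cvx t elim] by (intro outer_measure_of_mono) auto
      also have "\<dots> = emeasure \<mu> ({x. N x \<in> {t<..t+\<epsilon>}} \<union> {x. N x = t})"
        by (intro outer_measure_of_eq) auto
      also have "\<dots> = emeasure \<mu> {x. N x \<in> {t<..t+\<epsilon>}}"
      proof (rule emeasure_eq_AE)
        show "AE x in \<mu>. x \<in> ({x. N x \<in> {t<..t+\<epsilon>}} \<union> {x. N x = t}) \<longleftrightarrow> x \<in> {x. N x \<in> {t<..t+\<epsilon>}}"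
          using AE_mu_N_neq[of t] by eventually_elim auto
      qed (auto intro: borel_in_sets_mu)
      also have "\<dots> = emeasure scaled.profile_measure {t<..t+\<epsilon>}"
        using t by (intro emeasure_mu_radial) auto
      also have "\<dots> \<le> ennreal (\<epsilon> * \<psi> t)"
        using scaled.emeasure_Ioc_le[of t "t + \<epsilon>"] t elim by simp
      finally have "outer_measure_of \<mu> (minkowski_add {x. N x < t} \<epsilon> B - {x. N x < t}) / ennreal \<epsilon> \<le> ennreal (\<epsilon> * \<psi> t) / ennreal \<epsilon>"
        by (rule divide_right_mono_ennreal)
      also have "\<dots> = ennreal (\<psi> t)"
        using elim scaled.pos[of t] t by (subst divide_ennreal) auto
      finally show ?case by simp
    qed
  qed
  then show ?thesis by (simp add: Liminf_const)
qed

text \<open>The general lower bound depends only on the measure of the set, and at the measure of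
  this complement it equals the upper bound \<open>\<psi> t\<close> found for the dilate.\<close>

lemma isoperimetric_minimizer_homothetic:
  assumes cvx: "convex B" and t: "0 < t"
  shows "isoperimetric_minimizer \<mu> B (- ((*\<^sub>R) t ` B))"
proof -
  let ?C = "- {x. N x < t}"
  have C: "?C \<in> sets borel" by measurable
  note v = emeasure_mu_complement[OF t]
  have "inner_boundary_measure \<mu> B ?C \<le> inner_boundary_measure \<mu> B C'"
    if "C' \<in> sets borel" "emeasure \<mu> C' = emeasure \<mu> ?C" for C'
  proof -
    have "inner_boundary_measure \<mu> B ?C \<le> ennreal (\<psi> t)"
      by (rule inner_boundary_measure_homothetic_le[OF cvx t])
    also have "\<dots> = tail_profile \<psi> (emeasure \<mu> C')"
      unfolding that(2) v using t by (simp add: tail_profile_def scaled.tail_inv_tail ext_at_infinity_def)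
    also have "\<dots> \<le> inner_boundary_measure \<mu> B C'"
      using that v scaled.tail_finite[OF t] by (intro inner_boundary_measure_ge) auto
    finally show ?thesis .
  qed
  then have "inner_boundary_measure \<mu> B ?C = isoperimetric_profile \<mu> B (emeasure \<mu> ?C)"
    unfolding isoperimetric_profile_def using C by (intro antisym INF_greatest INF_lower) auto
  then show ?thesis
    unfolding isoperimetric_minimizer_def scaled_domain[OF t] using C by blast
qed

end

theorem theorem5p8:
  fixes B :: "(real ^ 'n) set" and \<rho> w0 :: "real ^ 'n \<Rightarrow> real" and \<phi> \<psi> :: "real \<Rightarrow> real"
    and c :: real and \<mu> :: "(real ^ 'n) measure"
  assumes "star_shaped_domain B \<rho>"
    and "w0 \<in> borel_measurable lebesgue" and "\<And>x. 0 \<le> w0 x" and "one_homogeneous w0"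
    and "set_integrable lebesgue B w0"
    and "\<And>s. 0 < s \<Longrightarrow> 0 \<le> \<phi> s" and "antimono_on {0<..} \<phi>" and "log_convex \<phi>"
    and "\<And>a. 0 < a \<Longrightarrow> \<not> set_integrable lborel {0<..<a} \<phi>"
    and "\<exists>a>0. set_integrable lborel {a..} \<phi>"
    and "\<mu> = radial_measure \<rho> w0 \<phi>"
    and "c = weight_const B w0"
    and "\<psi> = (\<lambda>s. c * \<phi> s)"
  shows "(\<forall>C\<in>sets borel. emeasure \<mu> C < \<infinity> \<longrightarrow>
            tail_profile \<psi> (emeasure \<mu> C) \<le> inner_boundary_measure \<mu> B C) \<and>
         (convex B \<longrightarrow> (\<forall>t>0. isoperimetric_minimizer \<mu> B (- ((*\<^sub>R) t ` B)))) \<and>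
         one_sided_complemented_concave \<mu> B (tail \<psi>) (tail_inv \<psi>)"
proof -
  interpret weighted_star_domain B \<rho> w0
    using assms(1-5) by unfold_locales
  have dens: "log_convex_density \<phi>"
    using assms(6-10) by (rule log_convex_densityI)
  interpret radial_star_measure B \<rho> w0 \<phi>
    using weighted_star_domain_axioms dens by (rule radial_star_measure.intro)
  show ?thesis
  \<comment> \<open>For c = 0 both \<mu> and \<psi> vanish, so the positivity behind the theory of
    tails is lost; all three claims then reduce to statements about 0.\<close>
  proof (cases "c = 0")
    case True
    then have zero: "emeasure \<mu> X = 0" for X
      using assms(11,12) emeasure_mu_degenerate by simp
    have outer: "outer_measure_of \<mu> X = 0" for X
    proof -
      have "outer_measure_of \<mu> X \<le> outer_measure_of \<mu> UNIV" by (rule outer_measure_of_mono) simp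
      also have "\<dots> = emeasure \<mu> UNIV"
        using assms(11) by (intro outer_measure_of_eq) simp
      finally show ?thesis using zero by simp
    qed
    have boundary: "inner_boundary_measure \<mu> B C = 0" for C
      unfolding inner_boundary_measure_def outer by (simp add: Liminf_const)
    have \<psi>: "\<psi> = (\<lambda>_. 0)" using True assms(13) by simp
    \<comment> \<open>Whatever \<open>tail_inv \<psi> 0\<close> is here, the zero function extended
      by 0 at \<infinity> has the value 0 there.\<close>
    have "tail_profile \<psi> 0 = 0"
      by (simp add: tail_profile_def ext_at_infinity_def \<psi>)
    moreover have "isoperimetric_minimizer \<mu> B (- ((*\<^sub>R) t ` B))" if "0 < t" for t
    proof -
      have borel: "- ((*\<^sub>R) t ` B) \<in> sets borel" unfolding scaled_domain[OF that] by measurable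
      then have "isoperimetric_profile \<mu> B (emeasure \<mu> (- ((*\<^sub>R) t ` B))) \<le> inner_boundary_measure \<mu> B (- ((*\<^sub>R) t ` B))"
        unfolding isoperimetric_profile_def by (intro INF_lower) simp
      then show ?thesis
        using borel by (simp add: isoperimetric_minimizer_def boundary)
    qed
    ultimately show ?thesis
      by (auto simp: zero boundary one_sided_complemented_concave_def inner_measure_of_def intro!: SUP_least)
  next
    case False
    then have "0 < weight_const B w0" using weight_const_nonneg assms(12) by simp
    then interpret nondegenerate_radial_star_measure B \<rho> w0 \<phi>
      by unfold_locales
    show ?thesis
      unfolding assms(11-13)
      using inner_boundary_measure_ge isoperimetric_minimizer_homothetic one_sided_complemented_concave_mu
      by blast
  qed
qed

end
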